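(* If $\Delta$ is a consistent set of formulas of $\mathcal{L}$, then $\Delta$ is satisfiable: there are a structure $\mathfrak{A}$ and a function $s\colon V\to|\mathfrak{A}|$ such that $\mathfrak{A}$ satisfies every member of $\Delta$ with $s$.
   Context: Language $\mathcal{L}$: first-order, with variables $V$ (which may occur free), individual constants, function symbols, predicate symbols, identity $=$, a one-place existence predicate $\exists!$, connectives $\neg,\rightarrow$ (others defined), quantifier $\forall$, and the binary quantifier $I$: if $A,B$ are formulas and $x$ a variable, $Ix[A,B]$ is a formula binding $x$ in $A$ and $B$. $A_t^x$ is substitution of $t$ for $x$ ($t$ free for $x$). Sequents $\Gamma\Rightarrow\Delta$ have finite sets of formulas on each side. The system $\mathbf{CPF}^I$ has axioms $A\Rightarrow A$ and the rules: Cut; weakening and contraction; $(L\neg)$: $\Gamma\Rightarrow\Delta,A$ / $\neg A,\Gamma\Rightarrow\Delta$; $(R\neg)$: $A,\Gamma\Rightarrow\Delta$ / $\Gamma\Rightarrow\Delta,\neg A$; $(L\rightarrow)$: $\Gamma\Rightarrow\Delta,A$ and $B,\Gamma\Rightarrow\Delta$ / $A\rightarrow B,\Gamma\Rightarrow\Delta$; $(R\rightarrow)$: $A,\Gamma\Rightarrow\Delta,B$ / $\Gamma\Rightarrow\Delta,A\rightarrow B$; $(L\forall)$: $A_t^x,\Gamma\Rightarrow\Delta$ / $\exists!t,\forall xA,\Gamma\Rightarrow\Delta$; $(R\forall)$: $\exists!a,\Gamma\Rightarrow\Delta,A_a^x$ / $\Gamma\Rightarrow\Delta,\forall xA$; identity: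 $A_{t_2}^x,\Gamma\Rightarrow\Delta$ / $t_1=t_2,A_{t_1}^x,\Gamma\Rightarrow\Delta$ ($A$ atomic), and $t=t,\Gamma\Rightarrow\Delta$ / $\Gamma\Rightarrow\Delta$; $(RI)$: $\Gamma\Rightarrow\Delta,A_t^x$, $\Gamma\Rightarrow\Delta,B_t^x$, $A_a^x,\Gamma\Rightarrow\Delta,a=t$ / $\Gamma\Rightarrow\Delta,Ix[A,B]$; $(LI^1)$: $A_a^x,B_a^x,\Gamma\Rightarrow\Delta$ / $Ix[A,B],\Gamma\Rightarrow\Delta$; $(LI^2)$: $\Gamma\Rightarrow\Delta,A_{t_1}^x$, $\Gamma\Rightarrow\Delta,A_{t_2}^x$, $\Gamma\Rightarrow\Delta,C_{t_2}^x$ / $Ix[A,B],\Gamma\Rightarrow\Delta,C_{t_1}^x$ ($C$ atomic). In $(R\forall)$, $(RI)$, $(LI^1)$ the eigen-term $a$ must not occur in the conclusion. $\Gamma\vdash A$ means: for some finite $\Gamma_0\subseteq\Gamma$, $\Gamma_0\Rightarrow A$ is derivable; $\Gamma$ is inconsistent iff $\Gamma\vdash\bot$ ($\bot$ an arbitrary contradiction), consistent otherwise. A structure $\mathfrak{A}$ consists of a non-empty domain $|\mathfrak{A}|$, an inner domain $|\mathfrak{A}^\forall|\subseteq|\mathfrak{A}|$ (possibly empty), which is also the interpretation of $\exists!$, relations $P^\mathfrak{A}\subseteq|\mathfrak{A}|^n$, elements $c^\mathfrak{A}\in|\mathfrak{A}|$, operations $f^\mathfrak{A}\colon|\mathfrak{A}|^n\to|\mathfrak{A}|$.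 For $s\colon V\to|\mathfrak{A}|$, $\overline{s}$ is its extension to terms and $s(x|d)$ is $s$ modified to send $x$ to $d$. Satisfaction: $\vDash_\mathfrak{A}t_1=t_2[s]$ iff $\overline{s}(t_1)=\overline{s}(t_2)$; $\vDash_\mathfrak{A}\exists!t[s]$ iff $\overline{s}(t)\in|\mathfrak{A}^\forall|$; atomic $Pt_1\dots t_n$ as usual; $\neg,\rightarrow$ classically; $\vDash_\mathfrak{A}\forall xA[s]$ iff $\vDash_\mathfrak{A}A[s(x|d)]$ for every $d\in|\mathfrak{A}^\forall|$; $\vDash_\mathfrak{A}Ix[A,B][s]$ iff there is $d\in|\mathfrak{A}|$ with $\vDash_\mathfrak{A}A[s(x|d)]$, no other $e\in|\mathfrak{A}|$ with $\vDash_\mathfrak{A}A[s(x|e)]$, and $\vDash_\mathfrak{A}B[s(x|d)]$. *)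

theory Defs
  imports Main
begin

text \<open>
  A language is given by its sets of non-logical symbols and their arities; the types of
  symbols are arbitrary, so languages of any cardinality are covered, and each of the three
  symbol sets may be empty. The variables are the natural numbers.
\<close>

record ('c, 'f, 'p) lang =
  csyms :: "'c set"
  fsyms :: "'f set"
  psyms :: "'p set"
  farity :: "'f \<Rightarrow> nat"
  parity :: "'p \<Rightarrow> nat"

datatype ('c, 'f) tm = Var nat | Const 'c | Fun 'f "('c, 'f) tm list"

text \<open>
  \<open>Exi t\<close> is the atomic formula \<open>\<exists>!t\<close> (existence of \<open>t\<close>, not unique existence);
  \<open>Iota x A B\<close> is \<open>Ix[A,B]\<close>, binding \<open>x\<close> in both \<open>A\<close> and \<open>B\<close>.
\<close>

datatype ('c, 'f, 'p) form =
    Eq "('c, 'f) tm" "('c, 'f) tm"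
  | Exi "('c, 'f) tm"
  | Pred 'p "('c, 'f) tm list"
  | Neg "('c, 'f, 'p) form"
  | Imp "('c, 'f, 'p) form" "('c, 'f, 'p) form"
  | All nat "('c, 'f, 'p) form"
  | Iota nat "('c, 'f, 'p) form" "('c, 'f, 'p) form"

primrec atomic :: "('c, 'f, 'p) form \<Rightarrow> bool" where
  "atomic (Eq t u) = True"
| "atomic (Exi t) = True"
| "atomic (Pred p ts) = True"
| "atomic (Neg A) = False"
| "atomic (Imp A B) = False"
| "atomic (All x A) = False"
| "atomic (Iota x A B) = False"

primrec wf_tm :: "('c, 'f, 'p) lang \<Rightarrow> ('c, 'f) tm \<Rightarrow> bool" where
  "wf_tm L (Var x) = True"
| "wf_tm L (Const c) = (c \<in> csyms L)"
| "wf_tm L (Fun f ts) = (f \<in> fsyms L \<and> length ts = farity L f \<and> list_all (wf_tm L) ts)"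

primrec wf_form :: "('c, 'f, 'p) lang \<Rightarrow> ('c, 'f, 'p) form \<Rightarrow> bool" where
  "wf_form L (Eq t u) = (wf_tm L t \<and> wf_tm L u)"
| "wf_form L (Exi t) = wf_tm L t"
| "wf_form L (Pred p ts) = (p \<in> psyms L \<and> length ts = parity L p \<and> list_all (wf_tm L) ts)"
| "wf_form L (Neg A) = wf_form L A"
| "wf_form L (Imp A B) = (wf_form L A \<and> wf_form L B)"
| "wf_form L (All x A) = wf_form L A"
| "wf_form L (Iota x A B) = (wf_form L A \<and> wf_form L B)"

primrec vars_tm :: "('c, 'f) tm \<Rightarrow> nat set" where
  "vars_tm (Var x) = {x}"
| "vars_tm (Const c) = {}"
| "vars_tm (Fun f ts) = \<Union> (set (map vars_tm ts))"

primrec fv :: "('c, 'f, 'p) form \<Rightarrow> nat set" where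
  "fv (Eq t u) = vars_tm t \<union> vars_tm u"
| "fv (Exi t) = vars_tm t"
| "fv (Pred p ts) = \<Union> (set (map vars_tm ts))"
| "fv (Neg A) = fv A"
| "fv (Imp A B) = fv A \<union> fv B"
| "fv (All x A) = fv A - {x}"
| "fv (Iota x A B) = (fv A \<union> fv B) - {x}"

text \<open>\<open>subst_tm x t u\<close> is \<open>u\<close> with \<open>t\<close> in place of \<open>x\<close>; \<open>subst x t A\<close> is \<open>A\<^sub>t\<^sup>x\<close>.
  Substitution does not rename bound variables, so it is only used under \<open>free_for\<close>.\<close>

primrec subst_tm :: "nat \<Rightarrow> ('c, 'f) tm \<Rightarrow> ('c, 'f) tm \<Rightarrow> ('c, 'f) tm" where
  "subst_tm x t (Var y) = (if y = x then t else Var y)"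
| "subst_tm x t (Const c) = Const c"
| "subst_tm x t (Fun f us) = Fun f (map (subst_tm x t) us)"

primrec subst :: "nat \<Rightarrow> ('c, 'f) tm \<Rightarrow> ('c, 'f, 'p) form \<Rightarrow> ('c, 'f, 'p) form" where
  "subst x t (Eq u v) = Eq (subst_tm x t u) (subst_tm x t v)"
| "subst x t (Exi u) = Exi (subst_tm x t u)"
| "subst x t (Pred p us) = Pred p (map (subst_tm x t) us)"
| "subst x t (Neg A) = Neg (subst x t A)"
| "subst x t (Imp A B) = Imp (subst x t A) (subst x t B)"
| "subst x t (All y A) = (if y = x then All y A else All y (subst x t A))"
| "subst x t (Iota y A B) =
     (if y = x then Iota y A B else Iota y (subst x t A) (subst x t B))"

primrec free_for :: "('c, 'f) tm \<Rightarrow> nat \<Rightarrow> ('c, 'f, 'p) form \<Rightarrow> bool" where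
  "free_for t x (Eq u v) = True"
| "free_for t x (Exi u) = True"
| "free_for t x (Pred p us) = True"
| "free_for t x (Neg A) = free_for t x A"
| "free_for t x (Imp A B) = (free_for t x A \<and> free_for t x B)"
| "free_for t x (All y A) =
     (x \<notin> fv (All y A) \<or> y \<notin> vars_tm t \<and> free_for t x A)"
| "free_for t x (Iota y A B) =
     (x \<notin> fv (Iota y A B) \<or> y \<notin> vars_tm t \<and> free_for t x A \<and> free_for t x B)"

text \<open>The terms occurring in a term or formula; bound variables, including those standing
  next to a quantifier, count as occurring.\<close>

primrec tms_tm :: "('c, 'f) tm \<Rightarrow> ('c, 'f) tm set" where
  "tms_tm (Var x) = {Var x}"
| "tms_tm (Const c) = {Const c}"
| "tms_tm (Fun f ts) = insert (Fun f ts) (\<Union> (set (map tms_tm ts)))"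

primrec tms :: "('c, 'f, 'p) form \<Rightarrow> ('c, 'f) tm set" where
  "tms (Eq t u) = tms_tm t \<union> tms_tm u"
| "tms (Exi t) = tms_tm t"
| "tms (Pred p ts) = \<Union> (set (map tms_tm ts))"
| "tms (Neg A) = tms A"
| "tms (Imp A B) = tms A \<union> tms B"
| "tms (All x A) = insert (Var x) (tms A)"
| "tms (Iota x A B) = insert (Var x) (tms A \<union> tms B)"

text \<open>Eigen-terms are variables or individual constants of the language (with compound
  eigen-terms the rules would be unsound). A variable eigen-term that does not occur in the
  conclusion is automatically free for \<open>x\<close> in the formulas concerned.\<close>

definition eigen :: "('c, 'f, 'p) lang \<Rightarrow> ('c, 'f) tm \<Rightarrow> ('c, 'f, 'p) form set \<Rightarrow> bool" where
  "eigen L a S \<longleftrightarrow>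
     wf_tm L a \<and> ((\<exists>y. a = Var y) \<or> (\<exists>c. a = Const c)) \<and> (\<forall>A\<in>S. a \<notin> tms A)"

text \<open>
  \<open>derivable L \<Gamma> \<Delta>\<close>: the sequent \<open>\<Gamma> \<Rightarrow> \<Delta>\<close> is derivable in \<open>CPF\<^sup>I\<close> over the language \<open>L\<close>.
  Both sides are sets; finiteness and membership in the language are preserved by the rules
  (lemma \<open>derivable_finite_wf\<close> below), and well-formedness premises are imposed just where
  a rule introduces material. On sets the contraction rules are vacuous.

  In \<open>RI\<close> the eigen-term must also be absent from \<open>t\<close>: otherwise, taking \<open>t\<close> to be \<open>a\<close>
  itself, the unsound sequent \<open>\<Rightarrow> Ix[x = x, x = x]\<close> would be derivable.
\<close>

inductive derivable ::
  "('c, 'f, 'p) lang \<Rightarrow> ('c, 'f, 'p) form set \<Rightarrow> ('c, 'f, 'p) form set \<Rightarrow> bool"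
  for L :: "('c, 'f, 'p) lang" where
  Ax: "wf_form L A \<Longrightarrow> derivable L {A} {A}"
| Cut: "derivable L \<Gamma> (insert A \<Delta>) \<Longrightarrow> derivable L (insert A \<Gamma>) \<Delta> \<Longrightarrow> derivable L \<Gamma> \<Delta>"
| LW: "derivable L \<Gamma> \<Delta> \<Longrightarrow> wf_form L A \<Longrightarrow> derivable L (insert A \<Gamma>) \<Delta>"
| RW: "derivable L \<Gamma> \<Delta> \<Longrightarrow> wf_form L A \<Longrightarrow> derivable L \<Gamma> (insert A \<Delta>)"
| LC: "derivable L (insert A (insert A \<Gamma>)) \<Delta> \<Longrightarrow> derivable L (insert A \<Gamma>) \<Delta>"
| RC: "derivable L \<Gamma> (insert A (insert A \<Delta>)) \<Longrightarrow> derivable L \<Gamma> (insert A \<Delta>)"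
| LNeg: "derivable L \<Gamma> (insert A \<Delta>) \<Longrightarrow> derivable L (insert (Neg A) \<Gamma>) \<Delta>"
| RNeg: "derivable L (insert A \<Gamma>) \<Delta> \<Longrightarrow> derivable L \<Gamma> (insert (Neg A) \<Delta>)"
| LImp: "derivable L \<Gamma> (insert A \<Delta>) \<Longrightarrow> derivable L (insert B \<Gamma>) \<Delta> \<Longrightarrow>
    derivable L (insert (Imp A B) \<Gamma>) \<Delta>"
| RImp: "derivable L (insert A \<Gamma>) (insert B \<Delta>) \<Longrightarrow> derivable L \<Gamma> (insert (Imp A B) \<Delta>)"
| LAll: "derivable L (insert (subst x t A) \<Gamma>) \<Delta> \<Longrightarrow> wf_tm L t \<Longrightarrow> free_for t x A \<Longrightarrow>
    derivable L (insert (Exi t) (insert (All x A) \<Gamma>)) \<Delta>"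
| RAll: "derivable L (insert (Exi a) \<Gamma>) (insert (subst x a A) \<Delta>) \<Longrightarrow>
    eigen L a (insert (All x A) (\<Gamma> \<union> \<Delta>)) \<Longrightarrow>
    derivable L \<Gamma> (insert (All x A) \<Delta>)"
| EqSubst: "derivable L (insert (subst x t2 A) \<Gamma>) \<Delta> \<Longrightarrow> atomic A \<Longrightarrow>
    wf_tm L t1 \<Longrightarrow> wf_tm L t2 \<Longrightarrow>
    derivable L (insert (Eq t1 t2) (insert (subst x t1 A) \<Gamma>)) \<Delta>"
| EqRefl: "derivable L (insert (Eq t t) \<Gamma>) \<Delta> \<Longrightarrow> derivable L \<Gamma> \<Delta>"
| RI: "derivable L \<Gamma> (insert (subst x t A) \<Delta>) \<Longrightarrow>
    derivable L \<Gamma> (insert (subst x t B) \<Delta>) \<Longrightarrow>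
    derivable L (insert (subst x a A) \<Gamma>) (insert (Eq a t) \<Delta>) \<Longrightarrow>
    free_for t x A \<Longrightarrow> free_for t x B \<Longrightarrow>
    eigen L a (insert (Iota x A B) (\<Gamma> \<union> \<Delta>)) \<Longrightarrow> a \<notin> tms_tm t \<Longrightarrow>
    derivable L \<Gamma> (insert (Iota x A B) \<Delta>)"
| LI1: "derivable L (insert (subst x a A) (insert (subst x a B) \<Gamma>)) \<Delta> \<Longrightarrow>
    eigen L a (insert (Iota x A B) (\<Gamma> \<union> \<Delta>)) \<Longrightarrow>
    derivable L (insert (Iota x A B) \<Gamma>) \<Delta>"
| LI2: "derivable L \<Gamma> (insert (subst x t1 A) \<Delta>) \<Longrightarrow>
    derivable L \<Gamma> (insert (subst x t2 A) \<Delta>) \<Longrightarrow>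
    derivable L \<Gamma> (insert (subst x t2 C) \<Delta>) \<Longrightarrow>
    atomic C \<Longrightarrow> wf_tm L t1 \<Longrightarrow> wf_tm L t2 \<Longrightarrow> wf_form L B \<Longrightarrow>
    free_for t1 x A \<Longrightarrow> free_for t2 x A \<Longrightarrow>
    derivable L (insert (Iota x A B) \<Gamma>) (insert (subst x t1 C) \<Delta>)"

lemma wf_subst_tm_D: "wf_tm L (subst_tm x t u) \<Longrightarrow> wf_tm L u"
  by (induction u) (auto simp: list_all_iff split: if_splits)

lemma wf_subst_D: "wf_form L (subst x t A) \<Longrightarrow> wf_form L A"
  by (induction A) (auto simp: list_all_iff split: if_splits dest: wf_subst_tm_D)

lemma wf_subst_tm: "wf_tm L t \<Longrightarrow> wf_tm L u \<Longrightarrow> wf_tm L (subst_tm x t u)"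
  by (induction u) (auto simp: list_all_iff)

lemma wf_subst: "wf_tm L t \<Longrightarrow> wf_form L A \<Longrightarrow> wf_form L (subst x t A)"
  by (induction A) (auto simp: list_all_iff wf_subst_tm)

lemma derivable_finite_wf:
  "derivable L \<Gamma> \<Delta> \<Longrightarrow> finite \<Gamma> \<and> finite \<Delta> \<and> (\<forall>A\<in>\<Gamma> \<union> \<Delta>. wf_form L A)"
  by (induction rule: derivable.induct) (auto dest: wf_subst_D intro: wf_subst)

definition proves :: "('c, 'f, 'p) lang \<Rightarrow> ('c, 'f, 'p) form set \<Rightarrow> ('c, 'f, 'p) form \<Rightarrow> bool" where
  "proves L \<Gamma> A \<longleftrightarrow> (\<exists>\<Gamma>0. finite \<Gamma>0 \<and> \<Gamma>0 \<subseteq> \<Gamma> \<and> derivable L \<Gamma>0 {A})"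

definition Conj :: "('c, 'f, 'p) form \<Rightarrow> ('c, 'f, 'p) form \<Rightarrow> ('c, 'f, 'p) form" where
  "Conj A B = Neg (Imp A (Neg B))"

definition inconsistent :: "('c, 'f, 'p) lang \<Rightarrow> ('c, 'f, 'p) form set \<Rightarrow> bool" where
  "inconsistent L \<Gamma> \<longleftrightarrow> (\<exists>A. wf_form L A \<and> proves L \<Gamma> (Conj A (Neg A)))"

abbreviation consistent :: "('c, 'f, 'p) lang \<Rightarrow> ('c, 'f, 'p) form set \<Rightarrow> bool" where
  "consistent L \<Gamma> \<equiv> \<not> inconsistent L \<Gamma>"

record ('c, 'f, 'p, 'd) struct =
  outer :: "'d set"
  inner :: "'d set"
  cint :: "'c \<Rightarrow> 'd"
  fint :: "'f \<Rightarrow> 'd list \<Rightarrow> 'd"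
  pint :: "'p \<Rightarrow> 'd list set"

definition is_struct :: "('c, 'f, 'p) lang \<Rightarrow> ('c, 'f, 'p, 'd) struct \<Rightarrow> bool" where
  "is_struct L M \<longleftrightarrow>
     outer M \<noteq> {} \<and> inner M \<subseteq> outer M \<and>
     (\<forall>c\<in>csyms L. cint M c \<in> outer M) \<and>
     (\<forall>f\<in>fsyms L. \<forall>ds. length ds = farity L f \<and> set ds \<subseteq> outer M \<longrightarrow> fint M f ds \<in> outer M) \<and>
     (\<forall>p\<in>psyms L. pint M p \<subseteq> {ds. length ds = parity L p \<and> set ds \<subseteq> outer M})"

primrec val :: "('c, 'f, 'p, 'd) struct \<Rightarrow> (nat \<Rightarrow> 'd) \<Rightarrow> ('c, 'f) tm \<Rightarrow> 'd" where
  "val M s (Var x) = s x"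
| "val M s (Const c) = cint M c"
| "val M s (Fun f ts) = fint M f (map (val M s) ts)"

primrec sat :: "('c, 'f, 'p, 'd) struct \<Rightarrow> (nat \<Rightarrow> 'd) \<Rightarrow> ('c, 'f, 'p) form \<Rightarrow> bool" where
  "sat M s (Eq t u) = (val M s t = val M s u)"
| "sat M s (Exi t) = (val M s t \<in> inner M)"
| "sat M s (Pred p ts) = (map (val M s) ts \<in> pint M p)"
| "sat M s (Neg A) = (\<not> sat M s A)"
| "sat M s (Imp A B) = (sat M s A \<longrightarrow> sat M s B)"
| "sat M s (All x A) = (\<forall>d\<in>inner M. sat M (s(x := d)) A)"
| "sat M s (Iota x A B) =
     (\<exists>d\<in>outer M. sat M (s(x := d)) A \<and>
        \<not> (\<exists>e\<in>outer M. e \<noteq> d \<and> sat M (s(x := e)) A) \<and>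
        sat M (s(x := d)) B)"

text \<open>
  A formula cannot quantify over types, so satisfiability fixes a type from which the domain
  is drawn as an arbitrary non-empty subset. The type of formulas is infinite and at least as
  large as the set of formulas of the language, so by the downward Loewenheim--Skolem argument
  this does not restrict the notion.
\<close>

definition satisfiable :: "('c, 'f, 'p) lang \<Rightarrow> ('c, 'f, 'p) form set \<Rightarrow> bool" where
  "satisfiable L \<Gamma> \<longleftrightarrow>
     (\<exists>(M :: ('c, 'f, 'p, ('c, 'f, 'p) form) struct) s.
        is_struct L M \<and> range s \<subseteq> outer M \<and> (\<forall>A\<in>\<Gamma>. sat M s A))"

end

theory Submission
  imports Defs
begin

text \<open>
  A Henkin construction. Extend the language by one constant for every possible demand for a
  witness: a counterexample to \<open>\<forall>xA\<close>, the thing that \<open>Ix[A,B]\<close> is about, or, when \<open>A\<close> and \<open>B\<close> hold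
  of \<open>k\<close> but \<open>Ix[A,B]\<close> fails, some \<open>c\<close> with \<open>A\<close> that is distinct from \<open>k\<close>. The axiom stating that
  such a demand is met can be removed from a refutation by \<open>R\<forall>\<close>, \<open>LI\<^sup>1\<close> or \<open>RI\<close> respectively, as long as
  its constant is fresh; removing axioms of maximal rank first guarantees this. A maximal consistent
  extension then yields a term model. Since \<open>Ix[x = t, x = t]\<close> is derivable, every term equals a
  constant there, so only substitutions of constants, which cannot be captured, are ever needed.
\<close>

subsection \<open>Derived rules\<close>

text \<open>Weakening adds one formula at a time, so the larger sets must be finite and well-formed;
  the left side is enlarged first, then the right.\<close>

lemma derivable_mono:
  assumes "derivable L \<Gamma> \<Delta>" "\<Gamma> \<subseteq> \<Gamma>'" "\<Delta> \<subseteq> \<Delta>'" "finite \<Gamma>'" "finite \<Delta>'"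
    and "\<forall>A\<in>\<Gamma>' \<union> \<Delta>'. wf_form L A"
  shows "derivable L \<Gamma>' \<Delta>'"
proof -
  have l: "derivable L (\<Gamma> \<union> F) \<Delta>" if "finite F" "\<forall>A\<in>F. wf_form L A" for F
    using that by (induction F) (auto intro: assms(1) LW)
  have r: "derivable L (\<Gamma> \<union> \<Gamma>') (\<Delta> \<union> F)" if "finite F" "\<forall>A\<in>F. wf_form L A" for F
    using that by (induction F) (use l[of \<Gamma>'] assms in \<open>auto intro: RW\<close>)
  from r[of \<Delta>'] assms show ?thesis
    by (simp add: Un_absorb1)
qed

lemma derivable_Ax:
  assumes "A \<in> \<Gamma>" "A \<in> \<Delta>" "finite \<Gamma>" "finite \<Delta>" "\<forall>A\<in>\<Gamma> \<union> \<Delta>. wf_form L A"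
  shows "derivable L \<Gamma> \<Delta>"
  by (rule derivable_mono[OF Ax[of L A]]) (use assms in auto)

lemma derivable_cut:
  assumes "derivable L \<Gamma> (insert A \<Delta>)" "derivable L (insert A \<Gamma>') \<Delta>'"
  shows "derivable L (\<Gamma> \<union> \<Gamma>') (\<Delta> \<union> \<Delta>')"
proof (rule Cut)
  note wf = derivable_finite_wf[OF assms(1)] derivable_finite_wf[OF assms(2)]
  show "derivable L (\<Gamma> \<union> \<Gamma>') (insert A (\<Delta> \<union> \<Delta>'))"
    by (rule derivable_mono[OF assms(1)]) (use wf in auto)
  show "derivable L (insert A (\<Gamma> \<union> \<Gamma>')) (\<Delta> \<union> \<Delta>')"
    by (rule derivable_mono[OF assms(2)]) (use wf in auto)
qed

lemma derivable_cut_same: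
  assumes "derivable L \<Gamma> (insert A \<Delta>)" "derivable L (insert A \<Gamma>) \<Delta>"
  shows "derivable L \<Gamma> \<Delta>"
  using derivable_cut[OF assms] by simp

text \<open>Negation and implication are inverted by cutting against a short derivable sequent, here
  \<open>\<Rightarrow> Neg A, A\<close>.\<close>

lemma LNeg_inv:
  assumes "derivable L (insert (Neg A) \<Gamma>) \<Delta>"
  shows "derivable L \<Gamma> (insert A \<Delta>)"
proof -
  have wf: "wf_form L A"
    using derivable_finite_wf[OF assms] by simp
  have "derivable L {} (insert (Neg A) {A})"
    by (rule RNeg) (rule Ax[OF wf])
  from derivable_cut[OF this assms] show ?thesis
    by simp
qed

lemma RNeg_inv:
  assumes "derivable L \<Gamma> (insert (Neg A) \<Delta>)"
  shows "derivable L (insert A \<Gamma>) \<Delta>"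
proof -
  have wf: "wf_form L A"
    using derivable_finite_wf[OF assms] by simp
  have "derivable L (insert (Neg A) {A}) {}"
    by (rule LNeg) (rule Ax[OF wf])
  from derivable_cut[OF assms this] show ?thesis
    by simp
qed

lemma RImp_inv:
  assumes "derivable L \<Gamma> (insert (Imp A B) \<Delta>)"
  shows "derivable L (insert A \<Gamma>) (insert B \<Delta>)"
proof -
  have wf: "wf_form L A" "wf_form L B"
    using derivable_finite_wf[OF assms] by simp_all
  have "derivable L (insert (Imp A B) {A}) {B}"
    by (rule LImp) (use wf in \<open>auto intro: derivable_Ax\<close>)
  from derivable_cut[OF assms this] show ?thesis
    by simp
qed

lemma LImp_inv:
  assumes "derivable L (insert (Imp A B) \<Gamma>) \<Delta>"
  shows "derivable L \<Gamma> (insert A \<Delta>)" "derivable L (insert B \<Gamma>) \<Delta>"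
proof -
  have wf: "wf_form L A" "wf_form L B"
    using derivable_finite_wf[OF assms] by simp_all
  have "derivable L {} (insert (Imp A B) {A})" "derivable L {B} (insert (Imp A B) {})"
    by (rule RImp, use wf in \<open>auto intro: derivable_Ax\<close>)+
  from this[THEN derivable_cut, OF assms]
  show "derivable L \<Gamma> (insert A \<Delta>)" "derivable L (insert B \<Gamma>) \<Delta>"
    by simp_all
qed

lemma derivable_Eq_refl: "wf_tm L t \<Longrightarrow> derivable L {} {Eq t t}"
  by (rule EqRefl[of _ t]) (simp add: Ax)

text \<open>The empty succedent is the working form of inconsistency; right weakening supplies the
  contradiction that the official definition asks for.\<close>

lemma inconsistentI:
  assumes "derivable L \<Gamma>0 {}" "\<Gamma>0 \<subseteq> \<Gamma>"
  shows "inconsistent L \<Gamma>"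
proof -
  let ?A = "Eq (Var 0) (Var 0)"
  have "derivable L \<Gamma>0 {Conj ?A (Neg ?A)}"
    by (rule derivable_mono[OF assms(1)])
      (use derivable_finite_wf[OF assms(1)] in \<open>auto simp: Conj_def\<close>)
  moreover have "finite \<Gamma>0"
    using derivable_finite_wf[OF assms(1)] by blast
  ultimately show ?thesis
    unfolding inconsistent_def proves_def using assms(2)
    by (intro exI[of _ ?A] conjI exI[of _ \<Gamma>0]) simp_all
qed

subsection \<open>Substitution\<close>

lemma finite_vars_tm [simp]: "finite (vars_tm t)"
  by (induction t) auto

lemma finite_tms_tm [simp]: "finite (tms_tm t)"
  by (induction t) auto

lemma finite_tms [simp]: "finite (tms A)"
  by (induction A) auto

lemma finite_nat_avoid: "finite (X :: nat set) \<Longrightarrow> \<exists>x. x \<notin> X"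
  using infinite_UNIV_nat by (metis UNIV_I finite_subset subsetI)

lemma subst_tm_fresh [simp]: "x \<notin> vars_tm u \<Longrightarrow> subst_tm x t u = u"
  by (induction u) (auto intro: map_idI)

lemma free_for_Const [simp]: "free_for (Const c) x A"
  by (induction A) auto

lemma val_subst_tm: "val M s (subst_tm x t u) = val M (s(x := val M s t)) u"
  by (induction u) (auto cong: map_cong)

text \<open>The value of a constant does not depend on the assignment, so the substitution lemma
  passes binders without any condition on capture.\<close>

lemma sat_subst_Const:
  "sat M s (subst x (Const c) A) = sat M (s(x := cint M c)) A"
proof (induction A arbitrary: s)
  case (Pred p ts)
  have "map (val M s \<circ> subst_tm x (Const c)) ts = map (val M (s(x := cint M c))) ts"
    by (simp add: val_subst_tm)
  then show ?case by (simp only: subst.simps sat.simps map_map)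
next
  case (All y A)
  show ?case
  proof (cases "y = x")
    case False
    then show ?thesis by (simp add: All fun_upd_twist[of x] del: fun_upd_apply)
  qed (simp del: fun_upd_apply)
next
  case (Iota y A B)
  show ?case
  proof (cases "y = x")
    case False
    then show ?thesis by (simp add: Iota fun_upd_twist[of x] del: fun_upd_apply)
  qed (simp del: fun_upd_apply)
qed (simp_all add: val_subst_tm)

text \<open>Substitution instances are not subformulas, so the truth lemma inducts on this measure,
  which ignores terms. It also ranks the witness constants, which are themselves formulas.\<close>

primrec depth :: "('c, 'f, 'p) form \<Rightarrow> nat" where
  "depth (Eq t u) = 0"
| "depth (Exi t) = 0"
| "depth (Pred p ts) = 0"
| "depth (Neg A) = Suc (depth A)"
| "depth (Imp A B) = Suc (max (depth A) (depth B))"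
| "depth (All x A) = Suc (depth A)"
| "depth (Iota x A B) = Suc (max (depth A) (depth B))"

lemma depth_subst [simp]: "depth (subst x t A) = depth A"
  by (induction A) auto

subsection \<open>The term model\<close>

locale maximal_consistent =
  fixes L :: "('c, 'f, 'p) lang" and G :: "('c, 'f, 'p) form set"
  assumes wf: "A \<in> G \<Longrightarrow> wf_form L A"
    and con: "\<Gamma> \<subseteq> G \<Longrightarrow> \<not> derivable L \<Gamma> {}"
    and maximal: "wf_form L A \<Longrightarrow> A \<notin> G \<Longrightarrow> \<exists>\<Gamma>\<subseteq>G. derivable L (insert A \<Gamma>) {}"
begin

text \<open>By maximality each succedent formula outside \<open>G\<close> is refuted with the help
  of \<open>G\<close>, so a cut removes it. Removing all of them would refute a part of
  \<open>G\<close>.\<close>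

lemma derivable_meets:
  assumes "derivable L \<Gamma> \<Delta>" "\<Gamma> \<subseteq> G"
  shows "\<exists>A\<in>\<Delta>. A \<in> G"
proof -
  have "finite \<Delta>" using derivable_finite_wf[OF assms(1)] by simp
  then show ?thesis using assms
  proof (induction \<Delta> arbitrary: \<Gamma>)
    case empty
    then show ?case using con by blast
  next
    case (insert A \<Delta>)
    show ?case
    proof (cases "A \<in> G")
      case False
      moreover have "wf_form L A"
        using derivable_finite_wf[OF insert.prems(1)] by simp
      ultimately obtain \<Gamma>' where "\<Gamma>' \<subseteq> G" "derivable L (insert A \<Gamma>') {}"
        using maximal by blast
      with derivable_cut[OF insert.prems(1) this(2)] insert.IH[of "\<Gamma> \<union> \<Gamma>'"] insert.prems
      show ?thesis by simp
    qed simp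
  qed
qed

lemma closed: "derivable L \<Gamma> {A} \<Longrightarrow> \<Gamma> \<subseteq> G \<Longrightarrow> A \<in> G"
  using derivable_meets by blast

lemma Neg_iff:
  assumes "wf_form L A"
  shows "Neg A \<in> G \<longleftrightarrow> A \<notin> G"
proof
  have "derivable L (insert (Neg A) {A}) {}"
    by (rule LNeg) (rule Ax[OF assms])
  then show "A \<notin> G" if "Neg A \<in> G"
    using that con[of "{Neg A, A}"] by auto
  have "derivable L {} (insert (Neg A) {A})"
    by (rule RNeg) (rule Ax[OF assms])
  then show "Neg A \<in> G" if "A \<notin> G"
    using that derivable_meets[of "{}" "{Neg A, A}"] by auto
qed

lemma Imp_iff:
  assumes "wf_form L A" "wf_form L B"
  shows "Imp A B \<in> G \<longleftrightarrow> (A \<in> G \<longrightarrow> B \<in> G)"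
proof
  have "derivable L (insert (Imp A B) {A}) {B}"
    by (rule LImp) (use assms in \<open>auto intro: derivable_Ax\<close>)
  then show "A \<in> G \<longrightarrow> B \<in> G" if "Imp A B \<in> G"
    using that closed by blast
  have "derivable L {} (insert (Imp A B) {A})" "derivable L {B} (insert (Imp A B) {})"
    by (rule RImp, use assms in \<open>auto intro: derivable_Ax\<close>)+
  then show "Imp A B \<in> G" if "A \<in> G \<longrightarrow> B \<in> G"
    using that derivable_meets[of "{}" "{Imp A B, A}"] closed[of "{B}"] by blast
qed

lemma Eq_refl: "wf_tm L t \<Longrightarrow> Eq t t \<in> G"
  using derivable_Eq_refl closed by blast

lemma Eq_subst:
  assumes "Eq t u \<in> G" "subst x t A \<in> G" "atomic A"
  shows "subst x u A \<in> G"
proof -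
  have w: "wf_tm L t" "wf_tm L u" "wf_form L (subst x u A)"
    using wf[OF assms(1)] wf[OF assms(2)] by (auto intro: wf_subst dest: wf_subst_D)
  have "derivable L (insert (Eq t u) (insert (subst x t A) {})) {subst x u A}"
    by (rule EqSubst) (use w assms(3) in \<open>auto intro: Ax\<close>)
  then show ?thesis using closed assms by blast
qed

text \<open>The fresh \<open>x\<close> marks the left place of \<open>t = t\<close>, so that only
  this occurrence of \<open>t\<close> is replaced by \<open>u\<close>.\<close>

lemma Eq_sym:
  assumes "Eq t u \<in> G"
  shows "Eq u t \<in> G"
proof -
  obtain x where "x \<notin> vars_tm t" using finite_nat_avoid finite_vars_tm by blast
  then show ?thesis
    using Eq_subst[OF assms, of x "Eq (Var x) t"] Eq_refl wf[OF assms] by simp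
qed

lemma Eq_trans:
  assumes "Eq t u \<in> G" "Eq u v \<in> G"
  shows "Eq t v \<in> G"
proof -
  obtain x where "x \<notin> vars_tm t" using finite_nat_avoid finite_vars_tm by blast
  then show ?thesis
    using Eq_subst[OF assms(2), of x "Eq t (Var x)"] assms(1) by simp
qed

text \<open>Arguments are exchanged from left to right, \<open>pre\<close> holding those already
  treated. A placeholder variable marks the current one; \<open>X\<close> collects the variables in
  the fixed part of the atomic context \<open>F\<close>, which the placeholder must avoid.\<close>

lemma Eq_subst_list:
  assumes "list_all2 (\<lambda>t u. Eq t u \<in> G) ts us" "F (pre @ ts) \<in> G"
    and "finite X"
    and "\<And>vs. atomic (F vs)"
    and subst_F: "\<And>x t vs. x \<notin> X \<Longrightarrow> subst x t (F vs) = F (map (subst_tm x t) vs)"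
  shows "F (pre @ us) \<in> G"
  using assms(1,2)
proof (induction arbitrary: pre)
  case (Cons t ts u us)
  have "finite (X \<union> (\<Union>v\<in>set (pre @ ts). vars_tm v))"
    using assms(3) by simp
  then obtain x where x: "x \<notin> X \<union> (\<Union>v\<in>set (pre @ ts). vars_tm v)"
    using finite_nat_avoid by blast
  then have "map (subst_tm x v) pre = pre" "map (subst_tm x v) ts = ts" for v :: "('c, 'f) tm"
    by (auto intro!: map_idI)
  with x have *: "subst x v (F (pre @ Var x # ts)) = F (pre @ v # ts)" for v
    by (simp add: subst_F)
  have "F ((pre @ [u]) @ ts) \<in> G"
    using Eq_subst[OF \<open>Eq t u \<in> G\<close>, of x "F (pre @ Var x # ts)"] * Cons.prems assms(4) by simp
  from Cons.IH[OF this] show ?case by simp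
qed simp

lemma Eq_Fun:
  assumes "list_all2 (\<lambda>t u. Eq t u \<in> G) ts us" "wf_tm L (Fun f ts)"
  shows "Eq (Fun f ts) (Fun f us) \<in> G"
proof -
  have "map (subst_tm x t) ts = ts" if "x \<notin> vars_tm (Fun f ts)" for x t
    using that by (auto intro!: map_idI)
  then show ?thesis
    using Eq_subst_list[of ts us "\<lambda>vs. Eq (Fun f ts) (Fun f vs)" "[]" "vars_tm (Fun f ts)"]
      assms(1) Eq_refl[OF assms(2)] finite_vars_tm by simp
qed

lemma Eq_Pred:
  assumes "list_all2 (\<lambda>t u. Eq t u \<in> G) ts us" "Pred p ts \<in> G"
  shows "Pred p us \<in> G"
  using Eq_subst_list[of ts us "Pred p" "[]" "{}"] assms by simp

lemma Eq_Exi: "Eq t u \<in> G \<Longrightarrow> Exi t \<in> G \<Longrightarrow> Exi u \<in> G"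
  using Eq_subst[of t u 0 "Exi (Var 0)"] by simp

text \<open>\<open>I\<close> quantifies over the outer domain, so \<open>Ix[x = t, x = t]\<close> says that \<open>t\<close> denotes.\<close>

lemma Iota_Eq:
  assumes "wf_tm L t" "x \<notin> vars_tm t"
  shows "Iota x (Eq (Var x) t) (Eq (Var x) t) \<in> G"
proof -
  obtain y where y: "y \<notin> insert x {y. Var y \<in> tms_tm t}"
    using finite_nat_avoid[of "insert x {y. Var y \<in> tms_tm t}"]
      finite_vimageI[of "tms_tm t" Var] by (auto simp: vimage_def inj_def)
  \<comment> \<open>With \<open>t\<close> as the object described, the first two premises of
    \<open>RI\<close> are \<open>\<Rightarrow> t = t\<close>, and the uniqueness premise is the
    axiom \<open>y = t \<Rightarrow> y = t\<close>.\<close>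
  have "derivable L {} (insert (Iota x (Eq (Var x) t) (Eq (Var x) t)) {})"
    by (rule RI[of _ _ _ t _ _ _ "Var y"])
      (use assms y in \<open>auto simp: eigen_def intro: derivable_Eq_refl Ax\<close>)
  then show ?thesis using closed by blast
qed

end

section \<open>Henkin sets and the model of representative constants\<close>

locale henkin_set = maximal_consistent L G
  for L :: "('c, 'f, 'p) lang" and G :: "('c, 'f, 'p) form set" +
  assumes wit_All: "wf_form L (All x A) \<Longrightarrow> All x A \<notin> G \<Longrightarrow>
      \<exists>c\<in>csyms L. Exi (Const c) \<in> G \<and> subst x (Const c) A \<notin> G"
    and wit_Iota: "Iota x A B \<in> G \<Longrightarrow>
      \<exists>c\<in>csyms L. subst x (Const c) A \<in> G \<and> subst x (Const c) B \<in> G"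
    and wit_unique: "wf_form L (Iota x A B) \<Longrightarrow> Iota x A B \<notin> G \<Longrightarrow> k \<in> csyms L \<Longrightarrow>
      subst x (Const k) A \<in> G \<Longrightarrow> subst x (Const k) B \<in> G \<Longrightarrow>
      \<exists>c\<in>csyms L. subst x (Const c) A \<in> G \<and> Eq (Const c) (Const k) \<notin> G"
begin

text \<open>A canonical constant for the class of \<open>t\<close> under the equality of
  \<open>G\<close>. The choice depends only on which constants equal \<open>t\<close>, so equal
  terms receive the same constant.\<close>

definition rep :: "('c, 'f) tm \<Rightarrow> 'c" where
  "rep t = (SOME c. Eq t (Const c) \<in> G)"

text \<open>\<open>Ix[x = t, x = t]\<close> lies in \<open>G\<close>, and its witness is a constant
  equal to \<open>t\<close>.\<close>

lemma Eq_rep: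
  assumes "wf_tm L t"
  shows "Eq t (Const (rep t)) \<in> G"
proof -
  obtain x where x: "x \<notin> vars_tm t" using finite_nat_avoid finite_vars_tm by blast
  from wit_Iota[OF Iota_Eq[OF assms x]] x obtain c where "Eq (Const c) t \<in> G"
    by auto
  then have "Eq t (Const c) \<in> G" by (rule Eq_sym)
  then show ?thesis unfolding rep_def by (rule someI)
qed

lemma rep_eq_iff:
  assumes "wf_tm L t" "wf_tm L u"
  shows "rep t = rep u \<longleftrightarrow> Eq t u \<in> G"
proof
  show "Eq t u \<in> G" if "rep t = rep u"
    using Eq_rep[OF assms(1)] Eq_rep[OF assms(2)] that Eq_sym Eq_trans by metis
  show "rep t = rep u" if "Eq t u \<in> G"
  proof -
    have "Eq t (Const c) \<in> G \<longleftrightarrow> Eq u (Const c) \<in> G" for c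
      using that Eq_sym Eq_trans by metis
    then show ?thesis unfolding rep_def by simp
  qed
qed

lemma wf_rep: "wf_tm L t \<Longrightarrow> wf_tm L (Const (rep t))"
  using wf[OF Eq_rep] by simp

lemma rep_csyms: "wf_tm L t \<Longrightarrow> rep t \<in> csyms L"
  using wf_rep by simp

lemma rep_rep: "wf_tm L t \<Longrightarrow> rep (Const (rep t)) = rep t"
  using rep_eq_iff Eq_sym[OF Eq_rep] wf_rep by blast

text \<open>The quotient of the terms by the equality of \<open>G\<close>, each class being replaced
  by its representative constant. The range condition in \<open>pint\<close> is there because
  \<open>G\<close> may contain predications of constants that are not representatives.\<close>

definition term_model :: "('c, 'f, 'p, 'c) struct" where
  "term_model =
    \<lparr>outer = rep ` {t. wf_tm L t}, inner = rep ` {t. Exi t \<in> G},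
     cint = (\<lambda>c. rep (Const c)), fint = (\<lambda>f ds. rep (Fun f (map Const ds))),
     pint = (\<lambda>p. {ds. Pred p (map Const ds) \<in> G \<and> set ds \<subseteq> rep ` {t. wf_tm L t}})\<rparr>"

lemma term_model_simps [simp]:
  "outer term_model = rep ` {t. wf_tm L t}"
  "inner term_model = rep ` {t. Exi t \<in> G}"
  "cint term_model c = rep (Const c)"
  "fint term_model f ds = rep (Fun f (map Const ds))"
  "ds \<in> pint term_model p \<longleftrightarrow> Pred p (map Const ds) \<in> G \<and> set ds \<subseteq> rep ` {t. wf_tm L t}"
  by (auto simp: term_model_def)

abbreviation "assign \<equiv> \<lambda>x. rep (Var x)"

lemma is_struct_term_model: "is_struct L term_model"
proof -
  have "wf_tm L (Var 0)" by simp
  then have "rep ` {t. wf_tm L t} \<noteq> {}" by blast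
  moreover have "rep ` {t. Exi t \<in> G} \<subseteq> rep ` {t. wf_tm L t}"
    using wf by fastforce
  moreover have "wf_tm L (Fun f (map Const ds))"
    if "f \<in> fsyms L" "length ds = farity L f" "set ds \<subseteq> rep ` {t. wf_tm L t}" for f ds
    using that rep_csyms by (fastforce simp: list_all_iff)
  moreover have "length ds = parity L p" if "Pred p (map Const ds) \<in> G" for p ds
    using wf[OF that] by simp
  ultimately show ?thesis
    unfolding is_struct_def by auto
qed

lemma Eq_rep_list:
  "list_all (wf_tm L) ts \<Longrightarrow> list_all2 (\<lambda>t u. Eq t u \<in> G) ts (map Const (map rep ts))"
  by (induction ts) (auto simp: Eq_rep)

lemma val_term_model: "wf_tm L t \<Longrightarrow> val term_model assign t = rep t"
proof (induction t)
  case (Fun f ts)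
  then have l: "list_all (wf_tm L) ts" by simp
  then have "map (val term_model assign) ts = map rep ts"
    using Fun by (auto simp: list_all_iff)
  moreover have eq: "Eq (Fun f ts) (Fun f (map Const (map rep ts))) \<in> G"
    using Eq_Fun[OF Eq_rep_list[OF l]] Fun.prems by simp
  moreover have "rep (Fun f ts) = rep (Fun f (map Const (map rep ts)))"
    using rep_eq_iff eq wf[OF eq] by simp
  ultimately show ?case by (simp only: val.simps term_model_simps)
qed simp_all

text \<open>\<open>LI2\<close> with \<open>c = x\<close> for its atomic formula carries the
  derivable \<open>c = c\<close> over to \<open>c = k\<close>.\<close>

lemma Eq_Const_unique:
  assumes "Iota x A B \<in> G" "subst x (Const c) A \<in> G" "subst x (Const k) A \<in> G"
    and "c \<in> csyms L" "k \<in> csyms L"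
  shows "Eq (Const c) (Const k) \<in> G"
proof -
  let ?C = "Eq (Const c) (Var x)" and ?\<Gamma> = "{subst x (Const k) A, subst x (Const c) A}"
  have w: "wf_form L A" "wf_form L B" using wf[OF assms(1)] by simp_all
  have "derivable L (insert (Iota x A B) ?\<Gamma>) (insert (subst x (Const k) ?C) {})"
  proof (rule LI2[of _ _ _ _ _ _ "Const c"])
    show "derivable L ?\<Gamma> (insert (subst x (Const c) ?C) {})"
      by (rule derivable_mono[OF derivable_Eq_refl[of L "Const c"]])
        (use assms w in \<open>auto intro: wf_subst\<close>)
    show "derivable L ?\<Gamma> (insert (subst x (Const k) A) {})"
      by (rule derivable_Ax[of "subst x (Const k) A"]) (use assms w in \<open>auto intro: wf_subst\<close>)
    show "derivable L ?\<Gamma> (insert (subst x (Const c) A) {})"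
      by (rule derivable_Ax[of "subst x (Const c) A"]) (use assms w in \<open>auto intro: wf_subst\<close>)
  qed (use assms w in auto)
  then show ?thesis using closed[of "insert (Iota x A B) ?\<Gamma>"] assms by simp
qed

text \<open>Every domain element is the value of a constant, so quantifiers over the domain become
  quantifiers over constants; there the witness conditions and the rules give the two directions of
  each quantifier case.\<close>

lemma truth: "wf_form L A \<Longrightarrow> sat term_model assign A \<longleftrightarrow> A \<in> G"
proof (induction A rule: measure_induct_rule[of depth])
  case (less A)
  let ?M = "term_model" and ?s = assign
  have IH: "sat ?M (?s(x := rep (Const c))) B \<longleftrightarrow> subst x (Const c) B \<in> G"
    if "depth B < depth A" "wf_form L B" "c \<in> csyms L" for x B c
  proof -
    have "sat ?M (?s(x := rep (Const c))) B = sat ?M ?s (subst x (Const c) B)"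
      unfolding sat_subst_Const by simp
    with less.IH[of "subst x (Const c) B"] that show ?thesis
      by (simp add: wf_subst)
  qed
  have outer: "outer ?M = (\<lambda>c. rep (Const c)) ` csyms L"

  proof -
    have "rep t = rep (Const (rep t)) \<and> rep t \<in> csyms L" if "wf_tm L t" for t
      using that rep_rep rep_csyms by simp
    moreover have "wf_tm L (Const c)" if "c \<in> csyms L" for c
      using that by simp
    ultimately show ?thesis unfolding term_model_simps by blast
  qed
  have inner: "inner ?M = (\<lambda>c. rep (Const c)) ` {c \<in> csyms L. Exi (Const c) \<in> G}"
  proof -
    have "\<exists>c. rep t = rep (Const c) \<and> c \<in> csyms L \<and> Exi (Const c) \<in> G" if "Exi t \<in> G" for t
      using that wf[OF that] rep_rep rep_csyms Eq_Exi[OF Eq_rep] by (metis wf_form.simps(2))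
    then show ?thesis
      unfolding term_model_simps by blast
  qed
  show ?case
  proof (cases A)
    case (Eq t u)
    then show ?thesis using less.prems by (simp add: val_term_model rep_eq_iff)
  next
    case (Exi t)
    then have t: "wf_tm L t" using less.prems by simp
    have "Exi t \<in> G" if "Exi u \<in> G" "rep t = rep u" for u
      using that t wf[OF that(1)] rep_eq_iff[of u t] Eq_Exi by simp
    then have "rep t \<in> inner ?M \<longleftrightarrow> Exi t \<in> G"
      by auto
    then show ?thesis using Exi t by (simp add: val_term_model)
  next
    case (Pred p ts)
    then have l: "list_all (wf_tm L) ts" using less.prems by simp
    then have m: "map (val ?M ?s) ts = map rep ts"
      by (auto simp: list_all_iff val_term_model)
    have e: "list_all2 (\<lambda>t u. Eq t u \<in> G) ts (map Const (map rep ts))"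
      by (rule Eq_rep_list[OF l])
    then have "list_all2 (\<lambda>t u. Eq t u \<in> G) (map Const (map rep ts)) ts"
      unfolding list_all2_conv_all_nth by (auto intro: Eq_sym)
    with e have "Pred p (map Const (map rep ts)) \<in> G \<longleftrightarrow> Pred p ts \<in> G"
      using Eq_Pred by blast
    moreover have "set (map rep ts) \<subseteq> rep ` {t. wf_tm L t}"
      using l by (auto simp: list_all_iff)
    ultimately show ?thesis
      by (simp only: Pred m sat.simps term_model_simps simp_thms)
  next
    case (Neg B)
    then show ?thesis using less by (simp add: Neg_iff)
  next
    case (Imp B C)
    then show ?thesis using less by (simp add: Imp_iff)
  next
    case (All x B)
    then have B: "wf_form L B" using less.prems by simp
    have "sat ?M ?s A \<longleftrightarrow> (\<forall>c\<in>csyms L. Exi (Const c) \<in> G \<longrightarrow> subst x (Const c) B \<in> G)"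
      using IH[of B] B All by (simp add: inner del: term_model_simps) blast
    also have "\<dots> \<longleftrightarrow> A \<in> G"
    proof
      show "A \<in> G" if "\<forall>c\<in>csyms L. Exi (Const c) \<in> G \<longrightarrow> subst x (Const c) B \<in> G"
        using that wit_All[of x B] less.prems All by blast
      have "derivable L (insert (Exi (Const c)) (insert (All x B) {})) {subst x (Const c) B}"
        if "c \<in> csyms L" for c
        by (rule LAll) (use that B in \<open>auto intro!: Ax wf_subst\<close>)
      then show "\<forall>c\<in>csyms L. Exi (Const c) \<in> G \<longrightarrow> subst x (Const c) B \<in> G" if "A \<in> G"
        using that closed All by blast
    qed
    finally show ?thesis .
  next
    case (Iota x B C)
    then have BC: "wf_form L B" "wf_form L C" using less.prems by simp_all
    have eq: "rep (Const c) = rep (Const k) \<longleftrightarrow> Eq (Const c) (Const k) \<in> G"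
      if "c \<in> csyms L" "k \<in> csyms L" for c k
      using that by (simp add: rep_eq_iff)
    \<comment> \<open>Two representatives differ exactly when the corresponding equation is absent
      from \<open>G\<close>.\<close>
    have "sat ?M ?s A \<longleftrightarrow> (\<exists>c\<in>csyms L. subst x (Const c) B \<in> G \<and>
        \<not> (\<exists>k\<in>csyms L. Eq (Const k) (Const c) \<notin> G \<and> subst x (Const k) B \<in> G) \<and>
        subst x (Const c) C \<in> G)"
      using IH[of B] IH[of C] BC Iota eq by (simp add: outer del: term_model_simps)
    also have "\<dots> \<longleftrightarrow> A \<in> G"
    proof
      assume "\<exists>c\<in>csyms L. subst x (Const c) B \<in> G \<and>
        \<not> (\<exists>k\<in>csyms L. Eq (Const k) (Const c) \<notin> G \<and> subst x (Const k) B \<in> G) \<and>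
        subst x (Const c) C \<in> G"
      \<comment> \<open>Were \<open>A\<close> not in \<open>G\<close>, \<open>wit_unique\<close>
        would give a constant with \<open>B\<close> that is not equated with \<open>c\<close>,
        against uniqueness.\<close>
      then show "A \<in> G" using wit_unique[of x B C] less.prems Iota by blast
    next
      assume "A \<in> G"
      then show "\<exists>c\<in>csyms L. subst x (Const c) B \<in> G \<and>
        \<not> (\<exists>k\<in>csyms L. Eq (Const k) (Const c) \<notin> G \<and> subst x (Const k) B \<in> G) \<and>
        subst x (Const c) C \<in> G"
        using wit_Iota[of x B C] Eq_Const_unique[of x B C] Iota by blast
    qed
    finally show ?thesis .
  qed
qed

lemma range_assign: "range assign \<subseteq> outer term_model"
proof -
  have "wf_tm L (Var x)" for x by simp
  then show ?thesis by auto
qed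

end

section \<open>Lindenbaum extension by Zorn's lemma\<close>

lemma ex_maximal_consistent:
  assumes "\<And>A. A \<in> T \<Longrightarrow> wf_form L A" "\<And>\<Gamma>. \<Gamma> \<subseteq> T \<Longrightarrow> \<not> derivable L \<Gamma> {}"
  obtains G where "T \<subseteq> G" "maximal_consistent L G"
proof -
  let ?C = "{G. T \<subseteq> G \<and> (\<forall>A\<in>G. wf_form L A) \<and> (\<forall>\<Gamma>\<subseteq>G. \<not> derivable L \<Gamma> {})}"
  have "T \<in> ?C" using assms by blast
  have "\<exists>U\<in>?C. \<forall>X\<in>\<C>. X \<subseteq> U" if "subset.chain ?C \<C>" for \<C>
  proof (cases "\<C> = {}")
    case True
    then show ?thesis using \<open>T \<in> ?C\<close> by blast
  next
    case False
    have \<C>: "T \<subseteq> X" "\<forall>A\<in>X. wf_form L A" "\<forall>\<Gamma>\<subseteq>X. \<not> derivable L \<Gamma> {}" if "X \<in> \<C>" for X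
      using that \<open>subset.chain ?C \<C>\<close> unfolding subset_chain_def by auto
    have "\<not> derivable L \<Gamma> {}" if "\<Gamma> \<subseteq> \<Union>\<C>" for \<Gamma>
    proof
      assume "derivable L \<Gamma> {}"
      then have "finite \<Gamma>" using derivable_finite_wf by blast
      \<comment> \<open>A refutation uses finitely many formulas, so a single member of the chain
        contains all of them.\<close>
      from finite_subset_Union_chain[OF this \<open>\<Gamma> \<subseteq> \<Union>\<C>\<close> False \<open>subset.chain ?C \<C>\<close>]
      obtain X where "X \<in> \<C>" "\<Gamma> \<subseteq> X" .
      with \<open>derivable L \<Gamma> {}\<close> \<C>(3) show False by blast
    qed
    moreover have "T \<subseteq> \<Union>\<C>" using False \<C>(1) by blast
    moreover have "\<forall>A\<in>\<Union>\<C>. wf_form L A" using \<C>(2) by blast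
    ultimately have "\<Union>\<C> \<in> ?C" by simp
    then show ?thesis by blast
  qed
  then obtain G where "G \<in> ?C" and max: "\<forall>X\<in>?C. G \<subseteq> X \<longrightarrow> X = G"
    using subset_Zorn[of ?C] by meson
  then have G: "T \<subseteq> G" "\<forall>A\<in>G. wf_form L A" "\<forall>\<Gamma>\<subseteq>G. \<not> derivable L \<Gamma> {}"
    by simp_all
  have "\<exists>\<Gamma>\<subseteq>G. derivable L (insert A \<Gamma>) {}" if A: "wf_form L A" "A \<notin> G" for A
  proof -
    have "insert A G \<notin> ?C"
    proof
      assume "insert A G \<in> ?C"
      from max[THEN bspec, OF this] have "insert A G = G" by (simp add: subset_insertI)
      with A(2) show False by blast
    qed
    moreover have "T \<subseteq> insert A G" "\<forall>B\<in>insert A G. wf_form L B"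
      using G A(1) by auto
    ultimately obtain \<Gamma> where \<Gamma>: "\<Gamma> \<subseteq> insert A G" "derivable L \<Gamma> {}"
      by auto
    \<comment> \<open>Weakening covers the case that \<open>A\<close> is not in
      \<open>\<Gamma>\<close>; taking \<open>A\<close> out leaves a part of
      \<open>G\<close>.\<close>
    from LW[OF \<Gamma>(2) A(1)] have "derivable L (insert A (\<Gamma> - {A})) {}" by simp
    moreover have "\<Gamma> - {A} \<subseteq> G" using \<Gamma>(1) by blast
    ultimately show ?thesis by blast
  qed
  then have "maximal_consistent L G"
    using G by (simp add: maximal_consistent_def)
  with G(1) show ?thesis by (rule that)
qed

subsection \<open>Renaming constants\<close>

text \<open>The two types of constants may differ and constants may become variables, so one map
  serves both for embedding a language and for undoing its extension.\<close>

primrec csubst_tm :: "('k \<Rightarrow> ('c, 'f) tm) \<Rightarrow> ('k, 'f) tm \<Rightarrow> ('c, 'f) tm" where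
  "csubst_tm \<rho> (Var x) = Var x"
| "csubst_tm \<rho> (Const k) = \<rho> k"
| "csubst_tm \<rho> (Fun f ts) = Fun f (map (csubst_tm \<rho>) ts)"

primrec csubst :: "('k \<Rightarrow> ('c, 'f) tm) \<Rightarrow> ('k, 'f, 'p) form \<Rightarrow> ('c, 'f, 'p) form" where
  "csubst \<rho> (Eq t u) = Eq (csubst_tm \<rho> t) (csubst_tm \<rho> u)"
| "csubst \<rho> (Exi t) = Exi (csubst_tm \<rho> t)"
| "csubst \<rho> (Pred p ts) = Pred p (map (csubst_tm \<rho>) ts)"
| "csubst \<rho> (Neg A) = Neg (csubst \<rho> A)"
| "csubst \<rho> (Imp A B) = Imp (csubst \<rho> A) (csubst \<rho> B)"
| "csubst \<rho> (All x A) = All x (csubst \<rho> A)"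
| "csubst \<rho> (Iota x A B) = Iota x (csubst \<rho> A) (csubst \<rho> B)"

lemma csubst_tm_comp: "csubst_tm \<rho> (csubst_tm \<sigma> t) = csubst_tm (\<lambda>k. csubst_tm \<rho> (\<sigma> k)) t"
  by (induction t) auto

lemma csubst_comp: "csubst \<rho> (csubst \<sigma> A) = csubst (\<lambda>k. csubst_tm \<rho> (\<sigma> k)) A"
  by (induction A) (auto simp: csubst_tm_comp)

lemma csubst_tm_Const [simp]: "csubst_tm Const t = t"
  by (induction t) (auto intro: map_idI)

lemma csubst_Const [simp]: "csubst Const A = A"
  by (induction A) (auto intro: map_idI)

lemma atomic_csubst [simp]: "atomic (csubst \<rho> A) = atomic A"
  by (cases A) auto

definition same_functions :: "('k, 'f, 'p) lang \<Rightarrow> ('c, 'f, 'p) lang \<Rightarrow> bool" where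
  "same_functions L L' \<longleftrightarrow> fsyms L = fsyms L' \<and> psyms L = psyms L' \<and>
     farity L = farity L' \<and> parity L = parity L'"

lemma wf_csubst_tm:
  assumes "same_functions L L'" "\<forall>k\<in>csyms L. wf_tm L' (\<rho> k)"
  shows "wf_tm L t \<Longrightarrow> wf_tm L' (csubst_tm \<rho> t)"
  by (induction t) (use assms in \<open>auto simp: same_functions_def list_all_iff\<close>)

lemma wf_csubst:
  assumes "same_functions L L'" "\<forall>k\<in>csyms L. wf_tm L' (\<rho> k)"
  shows "wf_form L A \<Longrightarrow> wf_form L' (csubst \<rho> A)"
  by (induction A)
    (use assms in \<open>auto simp: same_functions_def list_all_iff intro: wf_csubst_tm[OF assms]\<close>)

primrec atom_tm :: "('c, 'f) tm \<Rightarrow> bool" where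
  "atom_tm (Var x) = True"
| "atom_tm (Const c) = True"
| "atom_tm (Fun f ts) = False"

lemma atom_tm_iff: "atom_tm a \<longleftrightarrow> (\<exists>y. a = Var y) \<or> (\<exists>c. a = Const c)"
  by (cases a) auto

text \<open>Function applications are sent to function applications, so an atom in the image can
  only come from an atom. Freshness of an eigen-term can thus be checked on preimages.\<close>

lemma atom_in_tms_csubst_tm:
  assumes "\<And>k. atom_tm (\<rho> k)" "atom_tm a" "a \<in> tms_tm (csubst_tm \<rho> t)"
  shows "\<exists>b\<in>tms_tm t. atom_tm b \<and> a = csubst_tm \<rho> b"
  using assms(3)
proof (induction t)
  case (Const k)
  then show ?case using assms(1)[of k] assms(2) by (cases "\<rho> k") auto
next
  case (Fun f ts)
  then have "\<exists>t\<in>set ts. a \<in> tms_tm (csubst_tm \<rho> t)" using assms(2) by auto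
  with Fun.IH show ?case by fastforce
qed auto

lemma atom_in_tms_csubst:
  assumes "\<And>k. atom_tm (\<rho> k)" "atom_tm a" "a \<in> tms (csubst \<rho> A)"
  shows "\<exists>b\<in>tms A. atom_tm b \<and> a = csubst_tm \<rho> b"
  using assms(3)
proof (induction A)
  case (Pred p ts)
  then obtain t where "t \<in> set ts" "a \<in> tms_tm (csubst_tm \<rho> t)" by auto
  with atom_in_tms_csubst_tm[OF assms(1,2)] show ?case by fastforce
qed (use atom_in_tms_csubst_tm[OF assms(1,2)] in fastforce)+

text \<open>Only the variables and constants in \<open>S\<close> matter.\<close>

definition fresh_renaming ::
  "('k, 'f, 'p) lang \<Rightarrow> ('c, 'f, 'p) lang \<Rightarrow> ('k, 'f) tm set \<Rightarrow> ('k \<Rightarrow> ('c, 'f) tm) \<Rightarrow> bool" where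
  "fresh_renaming L L' S \<rho> \<longleftrightarrow> same_functions L L' \<and> (\<forall>k\<in>csyms L. wf_tm L' (\<rho> k)) \<and>
     (\<forall>k. atom_tm (\<rho> k)) \<and> (\<forall>k y. \<rho> k = Var y \<longrightarrow> Var y \<notin> S) \<and> inj_on \<rho> {k. Const k \<in> S}"

lemma fresh_renaming_mono:
  "fresh_renaming L L' S \<rho> \<Longrightarrow> S' \<subseteq> S \<Longrightarrow> fresh_renaming L L' S' \<rho>"
  unfolding fresh_renaming_def by (auto elim: inj_on_subset)

section \<open>Renamings and the side conditions of the rules\<close>

context
  fixes L :: "('k, 'f, 'p) lang" and L' :: "('c, 'f, 'p) lang" and S \<rho>
  assumes fr: "fresh_renaming L L' S \<rho>"
begin

lemma wf_tm_fresh: "wf_tm L t \<Longrightarrow> wf_tm L' (csubst_tm \<rho> t)"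
  using fr unfolding fresh_renaming_def by (blast intro: wf_csubst_tm)

lemma wf_form_fresh: "wf_form L A \<Longrightarrow> wf_form L' (csubst \<rho> A)"
  using fr unfolding fresh_renaming_def by (blast intro: wf_csubst)

lemma vars_fresh: "y \<in> vars_tm (\<rho> k) \<Longrightarrow> Var y \<notin> S"
  using fr unfolding fresh_renaming_def by (cases "\<rho> k") (auto, metis atom_tm.simps(3))

lemma vars_csubst_tm: "y \<in> vars_tm (csubst_tm \<rho> t) \<Longrightarrow> Var y \<in> S \<Longrightarrow> y \<in> vars_tm t"
  by (induction t) (auto dest: vars_fresh)

lemma fv_csubst: "y \<in> fv (csubst \<rho> A) \<Longrightarrow> Var y \<in> S \<Longrightarrow> y \<in> fv A"
  by (induction A) (auto dest: vars_csubst_tm)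

text \<open>A constant renamed to \<open>x\<close> would be replaced on the right but not on the
  left. New variables lie outside \<open>S\<close>, so \<open>Var x \<in> S\<close> excludes
  this.\<close>

lemma csubst_tm_subst_tm:
  "Var x \<in> S \<Longrightarrow> csubst_tm \<rho> (subst_tm x t u) = subst_tm x (csubst_tm \<rho> t) (csubst_tm \<rho> u)"
proof (induction u)
  case (Const k)
  then have "x \<notin> vars_tm (\<rho> k)" using vars_fresh by blast
  then show ?case by simp
qed auto

lemma csubst_subst:
  "Var x \<in> S \<Longrightarrow> csubst \<rho> (subst x t A) = subst x (csubst_tm \<rho> t) (csubst \<rho> A)"
  by (induction A) (auto simp: csubst_tm_subst_tm)

text \<open>The binders of \<open>A\<close> are variables in \<open>S\<close>, whereas renaming
  brings in only variables outside \<open>S\<close>, so none of these is captured.\<close>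

lemma free_for_csubst:
  "free_for t x A \<Longrightarrow> Var x \<in> S \<Longrightarrow> tms A \<subseteq> S \<Longrightarrow>
    free_for (csubst_tm \<rho> t) x (csubst \<rho> A)"
proof (induction A)
  case (All y A)
  then show ?case using fv_csubst[of x "All y A"] vars_csubst_tm[of y t] by auto
next
  case (Iota y A B)
  then show ?case using fv_csubst[of x "Iota y A B"] vars_csubst_tm[of y t] by auto
qed auto

text \<open>Two constants are kept apart by injectivity, a constant and a variable by the freshness
  of the new variables.\<close>

lemma csubst_tm_atom_inj:
  assumes "csubst_tm \<rho> a = csubst_tm \<rho> b" "atom_tm a" "atom_tm b" "a \<in> S" "b \<in> S"
  shows "a = b"
proof -
  have new: "Var y \<notin> S" if "\<rho> k = Var y" for k y
    using that fr unfolding fresh_renaming_def by blast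
  have inj: "inj_on \<rho> {k. Const k \<in> S}"
    using fr unfolding fresh_renaming_def by blast
  show ?thesis
    using assms new inj_onD[OF inj] by (cases a; cases b) (auto dest: sym)
qed

text \<open>If the image of \<open>a\<close> occurred in the image of a formula, an atom of that
  formula would share its image with \<open>a\<close>, hence be \<open>a\<close> by injectivity on
  \<open>S\<close>.\<close>

lemma eigen_csubst:
  assumes "eigen L a F" "a \<in> S" "\<forall>A\<in>F. tms A \<subseteq> S"
  shows "eigen L' (csubst_tm \<rho> a) (csubst \<rho> ` F)"
proof -
  have at: "atom_tm (\<rho> k)" for k using fr unfolding fresh_renaming_def by blast
  have a: "atom_tm a" "wf_tm L a" "\<forall>A\<in>F. a \<notin> tms A"
    using assms(1) by (auto simp: eigen_def atom_tm_iff)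
  have a': "atom_tm (csubst_tm \<rho> a)" using a(1) at by (cases a) auto
  have "csubst_tm \<rho> a \<notin> tms (csubst \<rho> A)" if "A \<in> F" for A
  proof
    assume "csubst_tm \<rho> a \<in> tms (csubst \<rho> A)"
    from atom_in_tms_csubst[OF at a' this] obtain b where
      "b \<in> tms A" "atom_tm b" "csubst_tm \<rho> a = csubst_tm \<rho> b" by blast
    with csubst_tm_atom_inj a that assms(2,3) show False by blast
  qed
  with a' a(2) show ?thesis
    by (auto simp: eigen_def atom_tm_iff[symmetric] intro: wf_tm_fresh)
qed

lemma notin_tms_csubst_tm:
  assumes "a \<notin> tms_tm t" "atom_tm a" "a \<in> S" "tms_tm t \<subseteq> S"
  shows "csubst_tm \<rho> a \<notin> tms_tm (csubst_tm \<rho> t)"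
proof
  assume *: "csubst_tm \<rho> a \<in> tms_tm (csubst_tm \<rho> t)"
  have at: "atom_tm (\<rho> k)" for k using fr unfolding fresh_renaming_def by blast
  have "atom_tm (csubst_tm \<rho> a)" using assms(2) at by (cases a) auto
  from atom_in_tms_csubst_tm[OF at this *] obtain b where
    "b \<in> tms_tm t" "atom_tm b" "csubst_tm \<rho> a = csubst_tm \<rho> b" by blast
  with csubst_tm_atom_inj assms show False by blast
qed

end

text \<open>A derivation involves only finitely many variables and constants, so its constants may be
  renamed apart into constants or unused variables, and it stays a derivation.\<close>

lemma derivable_csubst:
  fixes L :: "('k, 'f, 'p) lang" and L' :: "('c, 'f, 'p) lang"
  assumes "derivable L \<Gamma> \<Delta>"
  shows "\<exists>S. finite S \<and> (\<forall>\<rho>. fresh_renaming L L' S \<rho> \<longrightarrow>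
    derivable L' (csubst \<rho> ` \<Gamma>) (csubst \<rho> ` \<Delta>))"
  using assms
proof (induction rule: derivable.induct)
  case (Ax A)
  show ?case
    by (rule exI[of _ "{}"]) (auto intro!: derivable.Ax wf_form_fresh[of L L' "{}"] Ax)
next
  case (Cut \<Gamma> A \<Delta>)
  then obtain S1 S2 where S: "finite S1" "finite S2"
    "\<forall>\<rho>. fresh_renaming L L' S1 \<rho> \<longrightarrow>
      derivable L' (csubst \<rho> ` \<Gamma>) (csubst \<rho> ` insert A \<Delta>)"
    "\<forall>\<rho>. fresh_renaming L L' S2 \<rho> \<longrightarrow>
      derivable L' (csubst \<rho> ` insert A \<Gamma>) (csubst \<rho> ` \<Delta>)" by blast
  show ?case
  proof (rule exI[of _ "S1 \<union> S2"], intro conjI allI impI)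
    fix \<rho> assume fr: "fresh_renaming L L' (S1 \<union> S2) \<rho>"
    show "derivable L' (csubst \<rho> ` \<Gamma>) (csubst \<rho> ` \<Delta>)"
      by (rule derivable.Cut[of _ _ "csubst \<rho> A"])
        (use S(3,4) fr in \<open>auto dest: fresh_renaming_mono\<close>)
  qed (use S in simp)
next
  case (LW \<Gamma> \<Delta> A)
  then show ?case by (auto intro: derivable.LW wf_form_fresh)
next
  case (RW \<Gamma> \<Delta> A)
  then show ?case by (auto intro: derivable.RW wf_form_fresh)
next
  case (LC A \<Gamma> \<Delta>)
  then show ?case by simp
next
  case (RC \<Gamma> A \<Delta>)
  then show ?case by simp
next
  case (LNeg \<Gamma> A \<Delta>)
  then show ?case by (auto intro: derivable.LNeg)
next
  case (RNeg A \<Gamma> \<Delta>)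
  then show ?case by (auto intro: derivable.RNeg)
next
  case (LImp \<Gamma> A \<Delta> B)
  then obtain S1 S2 where S: "finite S1" "finite S2"
    "\<forall>\<rho>. fresh_renaming L L' S1 \<rho> \<longrightarrow>
      derivable L' (csubst \<rho> ` \<Gamma>) (csubst \<rho> ` insert A \<Delta>)"
    "\<forall>\<rho>. fresh_renaming L L' S2 \<rho> \<longrightarrow>
      derivable L' (csubst \<rho> ` insert B \<Gamma>) (csubst \<rho> ` \<Delta>)" by blast
  show ?case
  proof (rule exI[of _ "S1 \<union> S2"], intro conjI allI impI)
    fix \<rho> assume fr: "fresh_renaming L L' (S1 \<union> S2) \<rho>"
    show "derivable L' (csubst \<rho> ` insert (Imp A B) \<Gamma>) (csubst \<rho> ` \<Delta>)"
      unfolding image_insert csubst.simps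
      by (rule derivable.LImp) (use S(3,4) fr in \<open>auto dest: fresh_renaming_mono\<close>)
  qed (use S in simp)
next
  case (RImp A \<Gamma> B \<Delta>)
  then show ?case by (auto intro: derivable.RImp)
next
  case (LAll x t A \<Gamma> \<Delta>)
  then obtain S where S: "finite S"
    "\<forall>\<rho>. fresh_renaming L L' S \<rho> \<longrightarrow>
      derivable L' (csubst \<rho> ` insert (subst x t A) \<Gamma>) (csubst \<rho> ` \<Delta>)" by blast
  \<comment> \<open>The added terms include \<open>x\<close> and the binders of \<open>A\<close>,
    which the new variables have to avoid.\<close>
  let ?S = "S \<union> tms (All x A)"
  show ?case
  proof (rule exI[of _ ?S], intro conjI allI impI)
    fix \<rho> assume fr: "fresh_renaming L L' ?S \<rho>"
    have sub: "csubst \<rho> (subst x u D) = subst x (csubst_tm \<rho> u) (csubst \<rho> D)"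
      for u and D :: "('k, 'f, 'p) form"
      by (rule csubst_subst[OF fr]) simp
    have "fresh_renaming L L' S \<rho>" by (rule fresh_renaming_mono[OF fr]) auto
    from S(2)[rule_format, OF this] have
      "derivable L' (insert (subst x (csubst_tm \<rho> t) (csubst \<rho> A)) (csubst \<rho> ` \<Gamma>)) (csubst \<rho> ` \<Delta>)"
      by (simp add: sub)
    then show "derivable L' (csubst \<rho> ` insert (Exi t) (insert (All x A) \<Gamma>)) (csubst \<rho> ` \<Delta>)"
      unfolding image_insert csubst.simps
      by (rule derivable.LAll) (use LAll fr in \<open>auto intro: wf_tm_fresh free_for_csubst\<close>)
  qed (use S in simp)
next
  case (RAll a \<Gamma> x A \<Delta>)
  then obtain S where S: "finite S"
    "\<forall>\<rho>. fresh_renaming L L' S \<rho> \<longrightarrow>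
      derivable L' (csubst \<rho> ` insert (Exi a) \<Gamma>) (csubst \<rho> ` insert (subst x a A) \<Delta>)" by blast
  let ?F = "insert (All x A) (\<Gamma> \<union> \<Delta>)"
  \<comment> \<open>The eigen-term and all terms of the conclusion are included, so that renaming
    identifies no variable or constant of the conclusion with the eigen-term.\<close>
  let ?S = "insert a (S \<union> \<Union> (tms ` ?F))"
  show ?case
  proof (rule exI[of _ ?S], intro conjI allI impI)
    fix \<rho> assume fr: "fresh_renaming L L' ?S \<rho>"
    have sub: "csubst \<rho> (subst x u D) = subst x (csubst_tm \<rho> u) (csubst \<rho> D)"
      for u and D :: "('k, 'f, 'p) form"
      by (rule csubst_subst[OF fr]) simp
    have "fresh_renaming L L' S \<rho>" by (rule fresh_renaming_mono[OF fr]) auto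
    from S(2)[rule_format, OF this] have "derivable L' (insert (Exi (csubst_tm \<rho> a)) (csubst \<rho> ` \<Gamma>))
        (insert (subst x (csubst_tm \<rho> a) (csubst \<rho> A)) (csubst \<rho> ` \<Delta>))"
      by (simp add: sub)
    moreover have "eigen L' (csubst_tm \<rho> a) (csubst \<rho> ` ?F)"
      by (rule eigen_csubst[OF fr RAll.hyps(2)]) auto
    ultimately show "derivable L' (csubst \<rho> ` \<Gamma>) (csubst \<rho> ` insert (All x A) \<Delta>)"
      unfolding image_insert image_Un csubst.simps by (rule derivable.RAll)
  qed (use S derivable_finite_wf[OF RAll.hyps(1)] in simp)
next
  case (EqSubst x t2 A \<Gamma> \<Delta> t1)
  then obtain S where S: "finite S"
    "\<forall>\<rho>. fresh_renaming L L' S \<rho> \<longrightarrow>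
      derivable L' (csubst \<rho> ` insert (subst x t2 A) \<Gamma>) (csubst \<rho> ` \<Delta>)" by blast
  let ?S = "insert (Var x) S"
  show ?case
  proof (rule exI[of _ ?S], intro conjI allI impI)
    fix \<rho> assume fr: "fresh_renaming L L' ?S \<rho>"
    have sub: "csubst \<rho> (subst x u D) = subst x (csubst_tm \<rho> u) (csubst \<rho> D)"
      for u and D :: "('k, 'f, 'p) form"
      by (rule csubst_subst[OF fr]) simp
    have "fresh_renaming L L' S \<rho>" by (rule fresh_renaming_mono[OF fr]) auto
    from S(2)[rule_format, OF this] have
      "derivable L' (insert (subst x (csubst_tm \<rho> t2) (csubst \<rho> A)) (csubst \<rho> ` \<Gamma>)) (csubst \<rho> ` \<Delta>)"
      by (simp add: sub)
    then have "derivable L' (insert (Eq (csubst_tm \<rho> t1) (csubst_tm \<rho> t2))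
        (insert (subst x (csubst_tm \<rho> t1) (csubst \<rho> A)) (csubst \<rho> ` \<Gamma>))) (csubst \<rho> ` \<Delta>)"
      by (rule derivable.EqSubst) (use EqSubst fr in \<open>auto intro: wf_tm_fresh\<close>)
    then show "derivable L' (csubst \<rho> ` insert (Eq t1 t2) (insert (subst x t1 A) \<Gamma>))
        (csubst \<rho> ` \<Delta>)"
      by (simp add: sub)
  qed (use S in simp)
next
  case (EqRefl t \<Gamma> \<Delta>)
  then show ?case by (auto intro: derivable.EqRefl)
next
  case (RI \<Gamma> x t A \<Delta> B a)
  then obtain S1 S2 S3 where S: "finite S1" "finite S2" "finite S3"
    "\<forall>\<rho>. fresh_renaming L L' S1 \<rho> \<longrightarrow>
      derivable L' (csubst \<rho> ` \<Gamma>) (csubst \<rho> ` insert (subst x t A) \<Delta>)"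
    "\<forall>\<rho>. fresh_renaming L L' S2 \<rho> \<longrightarrow>
      derivable L' (csubst \<rho> ` \<Gamma>) (csubst \<rho> ` insert (subst x t B) \<Delta>)"
    "\<forall>\<rho>. fresh_renaming L L' S3 \<rho> \<longrightarrow>
      derivable L' (csubst \<rho> ` insert (subst x a A) \<Gamma>) (csubst \<rho> ` insert (Eq a t) \<Delta>)"
    by blast
  let ?F = "insert (Iota x A B) (\<Gamma> \<union> \<Delta>)"
  \<comment> \<open>The terms of \<open>t\<close> are included as well, since the eigen-term of
    \<open>RI\<close> must stay absent from \<open>t\<close>.\<close>
  let ?S = "insert a (tms_tm t \<union> S1 \<union> S2 \<union> S3 \<union> \<Union> (tms ` ?F))"
  show ?case
  proof (rule exI[of _ ?S], intro conjI allI impI)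
    fix \<rho> assume fr: "fresh_renaming L L' ?S \<rho>"
    have sub: "csubst \<rho> (subst x u D) = subst x (csubst_tm \<rho> u) (csubst \<rho> D)"
      for u and D :: "('k, 'f, 'p) form"
      by (rule csubst_subst[OF fr]) simp
    have "fresh_renaming L L' S1 \<rho>" "fresh_renaming L L' S2 \<rho>" "fresh_renaming L L' S3 \<rho>"
      by (rule fresh_renaming_mono[OF fr]; auto)+
    from S(4)[rule_format, OF this(1)] S(5)[rule_format, OF this(2)] S(6)[rule_format, OF this(3)] have
      "derivable L' (csubst \<rho> ` \<Gamma>)
        (insert (subst x (csubst_tm \<rho> t) (csubst \<rho> A)) (csubst \<rho> ` \<Delta>))"
      "derivable L' (csubst \<rho> ` \<Gamma>)
        (insert (subst x (csubst_tm \<rho> t) (csubst \<rho> B)) (csubst \<rho> ` \<Delta>))"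
      "derivable L' (insert (subst x (csubst_tm \<rho> a) (csubst \<rho> A)) (csubst \<rho> ` \<Gamma>))
        (insert (Eq (csubst_tm \<rho> a) (csubst_tm \<rho> t)) (csubst \<rho> ` \<Delta>))"
      by (simp_all add: sub)
    moreover have "free_for (csubst_tm \<rho> t) x (csubst \<rho> A)" "free_for (csubst_tm \<rho> t) x (csubst \<rho> B)"
      by (rule free_for_csubst[OF fr]; use RI in auto)+
    moreover have "eigen L' (csubst_tm \<rho> a) (csubst \<rho> ` ?F)"
      by (rule eigen_csubst[OF fr]) (use RI in auto)
    moreover have "csubst_tm \<rho> a \<notin> tms_tm (csubst_tm \<rho> t)"
      by (rule notin_tms_csubst_tm[OF fr]) (use RI in \<open>auto simp: eigen_def atom_tm_iff\<close>)
    ultimately show "derivable L' (csubst \<rho> ` \<Gamma>) (csubst \<rho> ` insert (Iota x A B) \<Delta>)"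
      unfolding image_insert image_Un csubst.simps by (rule derivable.RI)
  qed (use S derivable_finite_wf[OF RI.hyps(1)] in simp)
next
  case (LI1 x a A B \<Gamma> \<Delta>)
  then obtain S where S: "finite S"
    "\<forall>\<rho>. fresh_renaming L L' S \<rho> \<longrightarrow>
      derivable L' (csubst \<rho> ` insert (subst x a A) (insert (subst x a B) \<Gamma>)) (csubst \<rho> ` \<Delta>)"
    by blast
  let ?F = "insert (Iota x A B) (\<Gamma> \<union> \<Delta>)"
  let ?S = "insert a (S \<union> \<Union> (tms ` ?F))"
  show ?case
  proof (rule exI[of _ ?S], intro conjI allI impI)
    fix \<rho> assume fr: "fresh_renaming L L' ?S \<rho>"
    have sub: "csubst \<rho> (subst x u D) = subst x (csubst_tm \<rho> u) (csubst \<rho> D)"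
      for u and D :: "('k, 'f, 'p) form"
      by (rule csubst_subst[OF fr]) simp
    have "fresh_renaming L L' S \<rho>" by (rule fresh_renaming_mono[OF fr]) auto
    from S(2)[rule_format, OF this] have "derivable L' (insert (subst x (csubst_tm \<rho> a) (csubst \<rho> A))
        (insert (subst x (csubst_tm \<rho> a) (csubst \<rho> B)) (csubst \<rho> ` \<Gamma>))) (csubst \<rho> ` \<Delta>)"
      by (simp add: sub)
    moreover have "eigen L' (csubst_tm \<rho> a) (csubst \<rho> ` ?F)"
      by (rule eigen_csubst[OF fr LI1.hyps(2)]) auto
    ultimately show "derivable L' (csubst \<rho> ` insert (Iota x A B) \<Gamma>) (csubst \<rho> ` \<Delta>)"
      unfolding image_insert image_Un csubst.simps by (rule derivable.LI1)
  qed (use S derivable_finite_wf[OF LI1.hyps(1)] in simp)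
next
  case (LI2 \<Gamma> x t1 A \<Delta> t2 C B)
  then obtain S1 S2 S3 where S: "finite S1" "finite S2" "finite S3"
    "\<forall>\<rho>. fresh_renaming L L' S1 \<rho> \<longrightarrow>
      derivable L' (csubst \<rho> ` \<Gamma>) (csubst \<rho> ` insert (subst x t1 A) \<Delta>)"
    "\<forall>\<rho>. fresh_renaming L L' S2 \<rho> \<longrightarrow>
      derivable L' (csubst \<rho> ` \<Gamma>) (csubst \<rho> ` insert (subst x t2 A) \<Delta>)"
    "\<forall>\<rho>. fresh_renaming L L' S3 \<rho> \<longrightarrow>
      derivable L' (csubst \<rho> ` \<Gamma>) (csubst \<rho> ` insert (subst x t2 C) \<Delta>)"
    by blast
  let ?S = "S1 \<union> S2 \<union> S3 \<union> tms (Iota x A B)"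
  show ?case
  proof (rule exI[of _ ?S], intro conjI allI impI)
    fix \<rho> assume fr: "fresh_renaming L L' ?S \<rho>"
    have sub: "csubst \<rho> (subst x u D) = subst x (csubst_tm \<rho> u) (csubst \<rho> D)"
      for u and D :: "('k, 'f, 'p) form"
      by (rule csubst_subst[OF fr]) simp
    have "fresh_renaming L L' S1 \<rho>" "fresh_renaming L L' S2 \<rho>" "fresh_renaming L L' S3 \<rho>"
      by (rule fresh_renaming_mono[OF fr]; auto)+
    from S(4)[rule_format, OF this(1)] S(5)[rule_format, OF this(2)] S(6)[rule_format, OF this(3)] have
      "derivable L' (csubst \<rho> ` \<Gamma>)
        (insert (subst x (csubst_tm \<rho> t1) (csubst \<rho> A)) (csubst \<rho> ` \<Delta>))"
      "derivable L' (csubst \<rho> ` \<Gamma>)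
        (insert (subst x (csubst_tm \<rho> t2) (csubst \<rho> A)) (csubst \<rho> ` \<Delta>))"
      "derivable L' (csubst \<rho> ` \<Gamma>)
        (insert (subst x (csubst_tm \<rho> t2) (csubst \<rho> C)) (csubst \<rho> ` \<Delta>))"
      by (simp_all add: sub)
    moreover have "atomic (csubst \<rho> C)" "wf_tm L' (csubst_tm \<rho> t1)" "wf_tm L' (csubst_tm \<rho> t2)"
      "wf_form L' (csubst \<rho> B)"
      using LI2 wf_tm_fresh[OF fr] wf_form_fresh[OF fr] by simp_all
    moreover have "free_for (csubst_tm \<rho> t1) x (csubst \<rho> A)"
      "free_for (csubst_tm \<rho> t2) x (csubst \<rho> A)"
      by (rule free_for_csubst[OF fr]; use LI2 in auto)+
    ultimately have "derivable L' (insert (Iota x (csubst \<rho> A) (csubst \<rho> B)) (csubst \<rho> ` \<Gamma>))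
        (insert (subst x (csubst_tm \<rho> t1) (csubst \<rho> C)) (csubst \<rho> ` \<Delta>))"
      by (rule derivable.LI2)
    then show "derivable L' (csubst \<rho> ` insert (Iota x A B) \<Gamma>)
        (csubst \<rho> ` insert (subst x t1 C) \<Delta>)"
      by (simp add: sub)
  qed (use S in simp)
qed

subsection \<open>Henkin constants\<close>

datatype ('k, 'f, 'p) key =
    KAll nat "('k, 'f, 'p) form"
  | KIota nat "('k, 'f, 'p) form" "('k, 'f, 'p) form"
  | KUnique nat "('k, 'f, 'p) form" "('k, 'f, 'p) form" 'k

text \<open>
  The constants of the extended language are formulas of the original one: \<open>Exi (Const c)\<close> stands
  for the old constant \<open>c\<close>, and a negation codes a key, that is, a demand for a witness
  formulated in the extended language itself. Codes contain the constants they mention as proper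
  subformulas, so \<open>depth\<close> ranks the witnesses. The term model consists of constants, hence of
  elements of the type that \<open>satisfiable\<close> prescribes.
\<close>

primrec code_list :: "('c, 'f, 'p) form list \<Rightarrow> ('c, 'f, 'p) form" where
  "code_list [] = Exi (Var 0)"
| "code_list (A # As) = Imp A (code_list As)"

primrec code_tm :: "(('c, 'f, 'p) form, 'f) tm \<Rightarrow> ('c, 'f, 'p) form" where
  "code_tm (Var x) = Exi (Var x)"
| "code_tm (Const A) = Neg A"
| "code_tm (Fun f ts) = Imp (Exi (Fun f [])) (code_list (map code_tm ts))"

text \<open>The bound variable doubles as a tag: under \<open>Iota\<close>, \<open>0\<close> marks
  an equation and \<open>1\<close> an implication; under \<open>All\<close>, \<open>0\<close> marks
  a negation. The variables of genuine binders are shifted past these values.\<close>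

primrec code_form :: "(('c, 'f, 'p) form, 'f, 'p) form \<Rightarrow> ('c, 'f, 'p) form" where
  "code_form (Eq t u) = Iota 0 (code_tm t) (code_tm u)"
| "code_form (Exi t) = Neg (code_tm t)"
| "code_form (Pred p ts) = Imp (Pred p []) (code_list (map code_tm ts))"
| "code_form (Neg A) = All 0 (code_form A)"
| "code_form (Imp A B) = Iota (Suc 0) (code_form A) (code_form B)"
| "code_form (All x A) = All (Suc x) (code_form A)"
| "code_form (Iota x A B) = Iota (Suc (Suc x)) (code_form A) (code_form B)"

primrec code_key :: "(('c, 'f, 'p) form, 'f, 'p) key \<Rightarrow> ('c, 'f, 'p) form" where
  "code_key (KAll x A) = All x (code_form A)"
| "code_key (KIota x A B) = Iota x (code_form A) (code_form B)"
| "code_key (KUnique x A B k) = Imp (Iota x (code_form A) (code_form B)) k"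

lemma code_list_inject [simp]: "code_list As = code_list Bs \<longleftrightarrow> As = Bs"
proof (induction As arbitrary: Bs)
  case Nil
  then show ?case by (cases Bs) auto
next
  case (Cons A As)
  then show ?case by (cases Bs) auto
qed

lemma code_tm_inject [simp]: "code_tm t = code_tm u \<longleftrightarrow> t = u"
proof (induction t arbitrary: u)
  case (Fun f ts)
  have "map code_tm ts = map code_tm us \<longleftrightarrow> ts = us" for us
    using Fun.IH by (metis list.inj_map_strong)
  then show ?case by (cases u) auto
qed (case_tac u; auto)+

lemma map_code_tm_inject [simp]: "map code_tm ts = map code_tm us \<longleftrightarrow> ts = us"
  by (metis code_tm_inject list.inj_map_strong)

lemma code_form_inject [simp]: "code_form A = code_form B \<longleftrightarrow> A = B"
  by (induction A arbitrary: B) (case_tac B; auto)+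

lemma code_key_inject [simp]: "code_key K = code_key K' \<longleftrightarrow> K = K'"
  by (cases K; cases K') auto

definition Old :: "'c \<Rightarrow> ('c, 'f, 'p) form" where
  "Old c = Exi (Const c)"

definition Wit :: "(('c, 'f, 'p) form, 'f, 'p) key \<Rightarrow> ('c, 'f, 'p) form" where
  "Wit K = Neg (code_key K)"

lemma Old_Wit_simps [simp]:
  "Old c = Old d \<longleftrightarrow> c = d" "Wit K = Wit K' \<longleftrightarrow> K = K'" "Old c \<noteq> Wit K" "Wit K \<noteq> Old c"
  by (simp_all add: Old_def Wit_def)

text \<open>Gathers the constants and the well-formedness conditions of a key in one formula;
  \<open>Exi (Const k)\<close> is there to include \<open>k\<close>.\<close>

primrec key_form :: "('k, 'f, 'p) key \<Rightarrow> ('k, 'f, 'p) form" where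
  "key_form (KAll x A) = All x A"
| "key_form (KIota x A B) = Iota x A B"
| "key_form (KUnique x A B k) = Imp (Iota x A B) (Exi (Const k))"

lemma depth_code_list: "A \<in> set As \<Longrightarrow> depth A < depth (code_list As)"
  by (induction As) auto

lemma depth_code_tm: "Const A \<in> tms_tm t \<Longrightarrow> depth A < depth (code_tm t)"
proof (induction t)
  case (Fun f ts)
  then obtain t where "t \<in> set ts" "depth A < depth (code_tm t)" by auto
  with depth_code_list[of "code_tm t" "map code_tm ts"] show ?case by simp
qed auto

lemma depth_code_form: "Const A \<in> tms B \<Longrightarrow> depth A < depth (code_form B)"
proof (induction B)
  case (Pred p ts)
  then obtain t where "t \<in> set ts" "depth A < depth (code_tm t)"
    using depth_code_tm by auto
  with depth_code_list[of "code_tm t" "map code_tm ts"] show ?case by simp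
qed (auto dest: depth_code_tm)

text \<open>A code has every constant of its key as a proper subformula. Hence no witness occurs in
  its own demand, and witnesses can be ranked by depth.\<close>

lemma depth_Wit: "Const k \<in> tms (key_form K) \<Longrightarrow> depth k < depth (Wit K)"
  by (cases K) (auto simp: Wit_def dest!: depth_code_form)

section \<open>Henkin axioms and their conservativity\<close>

primrec hyp :: "('k, 'f, 'p) key \<Rightarrow> ('k, 'f, 'p) form" where
  "hyp (KAll x A) = Neg (All x A)"
| "hyp (KIota x A B) = Iota x A B"
| "hyp (KUnique x A B k) =
    Neg (Imp (subst x (Const k) A) (Imp (subst x (Const k) B) (Iota x A B)))"

primrec ante :: "('k, 'f, 'p) key \<Rightarrow> ('k, 'f) tm \<Rightarrow> ('k, 'f, 'p) form" where
  "ante (KAll x A) a = Exi a"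
| "ante (KIota x A B) a = subst x a A"
| "ante (KUnique x A B k) a = subst x a A"

primrec succ :: "('k, 'f, 'p) key \<Rightarrow> ('k, 'f) tm \<Rightarrow> ('k, 'f, 'p) form" where
  "succ (KAll x A) a = subst x a A"
| "succ (KIota x A B) a = Neg (subst x a B)"
| "succ (KUnique x A B k) a = Eq a (Const k)"

text \<open>Classically, \<open>hyp K\<close> yields \<open>ante\<close> and the failure of
  \<open>succ\<close> for the witness. In this shape, refuting the axiom gives both
  \<open>hyp K\<close> and the sequent \<open>ante \<Rightarrow> succ\<close>, which is up to a
  negation the eigen-term premise of the matching rule.\<close>

definition henkin :: "(('c, 'f, 'p) form, 'f, 'p) key \<Rightarrow> (('c, 'f, 'p) form, 'f, 'p) form" where
  "henkin K = Imp (hyp K) (Neg (Imp (ante K (Const (Wit K))) (succ K (Const (Wit K)))))"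

lemma wf_henkin:
  assumes "wf_form L (key_form K)" "Wit K \<in> csyms L"
  shows "wf_form L (henkin K)"
  using assms by (cases K) (auto simp: henkin_def intro: wf_subst)

lemma Const_in_tms_subst_tm:
  "Const c \<in> tms_tm (subst_tm x t u) \<Longrightarrow> Const c \<in> tms_tm u \<or> Const c \<in> tms_tm t"
  by (induction u) (auto split: if_splits)

lemma Const_in_tms_subst:
  "Const c \<in> tms (subst x t A) \<Longrightarrow> Const c \<in> tms A \<or> Const c \<in> tms_tm t"
  by (induction A) (auto split: if_splits dest: Const_in_tms_subst_tm)

lemma Const_in_tms_henkin:
  "Const c \<in> tms (henkin K) \<Longrightarrow> c = Wit K \<or> Const c \<in> tms (key_form K)"
  by (cases K) (auto simp: henkin_def dest!: Const_in_tms_subst)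

text \<open>Inverting the refutation, \<open>\<Gamma>\<close> proves \<open>hyp K\<close> and, with
  \<open>ante\<close>, also \<open>succ\<close>. With the fresh witness as eigen-term,
  \<open>RAll\<close>, \<open>LI1\<close> or \<open>RI\<close> turns the latter into a refutation of
  \<open>hyp K\<close>, and a cut finishes.\<close>

lemma henkin_eliminate:
  assumes der: "derivable L (insert (henkin K) \<Gamma>) {}"
    and wf: "wf_form L (key_form K)" "Wit K \<in> csyms L"
    and fresh: "\<forall>A\<in>\<Gamma>. Const (Wit K) \<notin> tms A"
  shows "derivable L \<Gamma> {}"
proof -
  let ?a = "Const (Wit K)"
  have "?a \<notin> tms (key_form K)" using depth_Wit[of "Wit K" K] by auto
  then have ei: "eigen L ?a (insert (key_form K) (\<Gamma> \<union> {}))"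
    using fresh wf by (auto simp: eigen_def)
  have hyp: "derivable L \<Gamma> {hyp K}"
    using LImp_inv(1)[OF der[unfolded henkin_def]] .
  have wit: "derivable L (insert (ante K ?a) \<Gamma>) {succ K ?a}"
    using RImp_inv[OF LNeg_inv[OF LImp_inv(2)[OF der[unfolded henkin_def]]]] .
  show ?thesis
  proof (cases K)
    case (KAll x A)
    have "derivable L \<Gamma> (insert (All x A) {})"
      by (rule RAll[of _ ?a]) (use wit ei KAll in simp_all)
    moreover have "derivable L (insert (All x A) \<Gamma>) {}"
      by (rule RNeg_inv) (use hyp KAll in simp)
    ultimately show ?thesis by (rule derivable_cut_same)
  next
    case (KIota x A B)
    have "derivable L (insert (Iota x A B) \<Gamma>) {}"
      by (rule LI1[of _ _ ?a])
        (use RNeg_inv[of L "insert (subst x ?a A) \<Gamma>" "subst x ?a B" "{}"] wit ei KIota in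
          \<open>simp_all add: insert_commute\<close>)
    then show ?thesis using derivable_cut_same[of L \<Gamma> "hyp K"] hyp KIota by simp
  next
    case (KUnique x A B k)
    have "derivable L
        (insert (Imp (subst x (Const k) A) (Imp (subst x (Const k) B) (Iota x A B))) \<Gamma>) {}"
      by (rule RNeg_inv) (use hyp KUnique in simp)
    note hyps = LImp_inv[OF this]
    note hyps' = LImp_inv[OF hyps(2)]
    \<comment> \<open>\<open>k\<close> is the object described: inverting the nested implications
      has given \<open>A\<close> and \<open>B\<close> for it, as well as a refutation of
      \<open>Ix[A,B]\<close>.\<close>
    have "derivable L \<Gamma> (insert (Iota x A B) {})"
    proof (rule RI[of _ _ _ "Const k" _ _ _ ?a])
      show "derivable L (insert (subst x ?a A) \<Gamma>) (insert (Eq ?a (Const k)) {})"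
        using wit KUnique by simp
      show "eigen L ?a (insert (Iota x A B) (\<Gamma> \<union> {}))" "?a \<notin> tms_tm (Const k)"
        using ei KUnique by (auto simp: eigen_def)
    qed (use hyps hyps' in simp_all)
    with hyps'(2) show ?thesis using derivable_cut_same by blast
  qed
qed

text \<open>The induction adds axioms by increasing witness depth, so the last one has maximal
  depth. Any other axiom contains, besides its own witness, only constants of smaller depth, so the
  last witness is fresh and its axiom can be eliminated.\<close>

lemma henkin_conservative:
  assumes "finite \<K>" "\<forall>K\<in>\<K>. wf_form L (key_form K) \<and> Wit K \<in> csyms L"
    and "\<forall>A\<in>\<Gamma>. \<forall>K. Const (Wit K) \<notin> tms A"
    and "derivable L (\<Gamma> \<union> henkin ` \<K>) {}"
  shows "derivable L \<Gamma> {}"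
  using assms(1,2,4)
proof (induction \<K> rule: finite_ranking_induct[where f = "\<lambda>K. depth (Wit K)"])
  case (insert K \<K>)
  show ?case
  proof (cases "K \<in> \<K>")
    case True
    then show ?thesis using insert by (simp add: insert_absorb)
  next
    case False
    have "Const (Wit K) \<notin> tms (henkin K')" if "K' \<in> \<K>" for K'
    proof
      assume "Const (Wit K) \<in> tms (henkin K')"
      then have "K = K' \<or> depth (Wit K) < depth (Wit K')"
        using Const_in_tms_henkin[of "Wit K" K'] depth_Wit by auto
      with False that insert.hyps(2)[OF that] show False by auto
    qed
    then have "\<forall>A\<in>\<Gamma> \<union> henkin ` \<K>. Const (Wit K) \<notin> tms A"
      using assms(3) by blast
    then have "derivable L (\<Gamma> \<union> henkin ` \<K>) {}"
      using insert.prems by (intro henkin_eliminate[of L K "\<Gamma> \<union> henkin ` \<K>"]) simp_all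
    with insert show ?thesis by simp
  qed
qed simp

section \<open>The extended language and the return to the original one\<close>

definition henkin_lang :: "('c, 'f, 'p) lang \<Rightarrow> (('c, 'f, 'p) form, 'f, 'p) lang" where
  "henkin_lang L = \<lparr>csyms = Old ` csyms L \<union> range Wit, fsyms = fsyms L, psyms = psyms L,
     farity = farity L, parity = parity L\<rparr>"

lemma henkin_lang_simps [simp]:
  "csyms (henkin_lang L) = Old ` csyms L \<union> range Wit"
  "fsyms (henkin_lang L) = fsyms L" "psyms (henkin_lang L) = psyms L"
  "farity (henkin_lang L) = farity L" "parity (henkin_lang L) = parity L"
  by (simp_all add: henkin_lang_def)

abbreviation embed :: "('c, 'f, 'p) form \<Rightarrow> (('c, 'f, 'p) form, 'f, 'p) form" where
  "embed \<equiv> csubst (\<lambda>c. Const (Old c))"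

lemma wf_embed: "wf_form L A \<Longrightarrow> wf_form (henkin_lang L) (embed A)"
  by (rule wf_csubst[of L]) (auto simp: same_functions_def)

lemma Wit_notin_embed:
  fixes A :: "('c, 'f, 'p) form"
  shows "Const (Wit K) \<notin> tms (embed A)"
proof
  assume "Const (Wit K) \<in> tms (embed A)"
  from atom_in_tms_csubst[OF _ _ this]
  obtain b :: "('c, 'f) tm" where
    "atom_tm b" "Const (Wit K) = csubst_tm (\<lambda>c. Const (Old c)) b" by auto
  then show False by (cases b) auto
qed

lemma derivable_embedD:
  fixes L :: "('c, 'f, 'p) lang"
  assumes "derivable (henkin_lang L) (embed ` \<Gamma>) {}"
  shows "derivable L \<Gamma> {}"
proof -
  from derivable_csubst[OF assms, of L] obtain S where S: "finite S"
    "\<And>\<rho>. fresh_renaming (henkin_lang L) L S \<rho> \<Longrightarrow> derivable L (csubst \<rho> ` embed ` \<Gamma>) {}"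
    by auto
  let ?K = "Const -` S" and ?V = "Var -` S"
  have "finite ?K" "finite ?V"
    using S(1) by (auto intro!: finite_vimageI simp: inj_def)
  then obtain g m where g: "inj_on (g :: _ \<Rightarrow> nat) ?K" and m: "\<forall>y\<in>?V. y < m"
    using finite_imp_inj_to_nat_seg[of ?K] finite_nat_set_iff_bounded[of ?V] by meson
  \<comment> \<open>\<open>m\<close> lies beyond all variables in \<open>S\<close>, and
    \<open>g\<close> numbers the finitely many constants in \<open>S\<close>, so distinct witnesses
    there get distinct new variables.\<close>
  define \<rho> :: "('c, 'f, 'p) form \<Rightarrow> ('c, 'f) tm" where
    "\<rho> k = (if k \<in> range Old then Const (the_inv Old k) else Var (m + g k))" for k
  have inj: "inj (Old :: 'c \<Rightarrow> ('c, 'f, 'p) form)" by (simp add: inj_def)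
  have old: "\<rho> (Old c) = Const c" for c
    by (simp add: \<rho>_def the_inv_f_f[OF inj])
  have new: "\<rho> k = Var (m + g k)" if "k \<notin> range Old" for k
    using that by (simp add: \<rho>_def)
  have "fresh_renaming (henkin_lang L) L S \<rho>"
    unfolding fresh_renaming_def
  proof (intro conjI allI ballI impI)
    show "same_functions (henkin_lang L) L" by (simp add: same_functions_def)
    show "wf_tm L (\<rho> k)" if "k \<in> csyms (henkin_lang L)" for k
      using that old new[of k] by fastforce
    show "atom_tm (\<rho> k)" for k
      by (simp add: \<rho>_def)
    show "Var y \<notin> S" if "\<rho> k = Var y" for k y
      using that m by (auto simp: \<rho>_def split: if_splits)
    show "inj_on \<rho> {k. Const k \<in> S}"
    proof (rule inj_onI)
      fix k k' assume k: "k \<in> {k. Const k \<in> S}" "k' \<in> {k. Const k \<in> S}" "\<rho> k = \<rho> k'"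
      show "k = k'"
      proof (cases "k \<in> range Old"; cases "k' \<in> range Old")
        assume "k \<notin> range Old" "k' \<notin> range Old"
        with k show ?thesis using new inj_onD[OF g, of k k'] by simp
      qed (use k old new in auto)
    qed
  qed
  with S(2) have "derivable L (csubst \<rho> ` embed ` \<Gamma>) {}" .
  then show ?thesis by (simp add: image_image csubst_comp old)
qed

text \<open>A refutation uses finitely many Henkin axioms, which are eliminated, and copies of
  members of \<open>\<Delta>\<close>, whose refutation translates back to \<open>L\<close>.\<close>

lemma henkin_theory_consistent:
  assumes "consistent L \<Delta>"
    and "\<Gamma> \<subseteq> embed ` \<Delta> \<union> henkin ` {K. wf_form (henkin_lang L) (key_form K)}"
  shows "\<not> derivable (henkin_lang L) \<Gamma> {}"
proof
  assume der: "derivable (henkin_lang L) \<Gamma> {}"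
  then have fin: "finite \<Gamma>" using derivable_finite_wf by blast
  obtain \<Delta>' where \<Delta>': "\<Delta>' \<subseteq> \<Delta>" "\<Gamma> \<inter> embed ` \<Delta> = embed ` \<Delta>'"
    using subset_imageE[of "\<Gamma> \<inter> embed ` \<Delta>" embed \<Delta>] by auto
  have "\<Gamma> - embed ` \<Delta> \<subseteq> henkin ` {K. wf_form (henkin_lang L) (key_form K)}"
    using assms(2) by blast
  from finite_subset_image[OF finite_Diff[OF fin] this] obtain \<K> where
    \<K>: "\<K> \<subseteq> {K. wf_form (henkin_lang L) (key_form K)}" "finite \<K>" "\<Gamma> - embed ` \<Delta> = henkin ` \<K>"
    by blast
  have \<Gamma>: "\<Gamma> = embed ` \<Delta>' \<union> henkin ` \<K>"
    using Int_Diff_Un[of \<Gamma> "embed ` \<Delta>"] unfolding \<Delta>'(2) \<K>(3) by (rule sym)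
  have keys: "\<forall>K\<in>\<K>. wf_form (henkin_lang L) (key_form K) \<and> Wit K \<in> csyms (henkin_lang L)"
    using \<K>(1) by auto
  have fresh: "\<forall>A\<in>embed ` \<Delta>'. \<forall>K. Const (Wit K) \<notin> tms A"
    by (simp add: Wit_notin_embed)
  have "derivable L \<Delta>' {}"
    by (rule derivable_embedD[OF henkin_conservative[OF \<K>(2) keys fresh der[unfolded \<Gamma>]]])
  from inconsistentI[OF this \<Delta>'(1)] assms(1) show False
    by (rule notE[rotated])
qed

text \<open>By maximality, an axiom in \<open>G\<close> says that \<open>hyp K\<close> is absent
  from \<open>G\<close> or \<open>Wit K\<close> meets the demand; the three kinds of keys give the
  three witness conditions.\<close>

lemma henkin_set_if_henkin_axioms:
  assumes "maximal_consistent (henkin_lang L) G"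
    and ax: "\<And>K. wf_form (henkin_lang L) (key_form K) \<Longrightarrow> henkin K \<in> G"
  shows "henkin_set (henkin_lang L) G"
proof -
  let ?L = "henkin_lang L"
  interpret maximal_consistent ?L G by (rule assms(1))
  have key: "hyp K \<notin> G \<or> ante K (Const (Wit K)) \<in> G \<and> succ K (Const (Wit K)) \<notin> G"
    if "wf_form ?L (key_form K)" for K
  proof -
    have "wf_form ?L (henkin K)" by (rule wf_henkin) (use that in simp_all)
    then show ?thesis
      using ax[OF that] unfolding henkin_def by (auto simp: Imp_iff Neg_iff)
  qed
  show ?thesis
  proof
    fix x A assume w: "wf_form ?L (All x A)" and n: "All x A \<notin> G"
    show "\<exists>c\<in>csyms ?L. Exi (Const c) \<in> G \<and> subst x (Const c) A \<notin> G"
      using key[of "KAll x A"] w n by (auto simp: Neg_iff)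
  next
    fix x A B assume i: "Iota x A B \<in> G"
    have "wf_form ?L (subst x (Const (Wit (KIota x A B))) B)"
      using wf[OF i] by (auto intro: wf_subst)
    then show "\<exists>c\<in>csyms ?L. subst x (Const c) A \<in> G \<and> subst x (Const c) B \<in> G"
      using key[of "KIota x A B"] i wf[OF i] by (auto simp: Neg_iff)
  next
    fix x A B k assume w: "wf_form ?L (Iota x A B)" and n: "Iota x A B \<notin> G"
      and k: "k \<in> csyms ?L" "subst x (Const k) A \<in> G" "subst x (Const k) B \<in> G"
    have "hyp (KUnique x A B k) \<in> G"
      using w n k wf[OF k(2)] wf[OF k(3)] by (simp add: Neg_iff Imp_iff)
    then show "\<exists>c\<in>csyms ?L. subst x (Const c) A \<in> G \<and> Eq (Const c) (Const k) \<notin> G"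
      using key[of "KUnique x A B k"] w k(1) by auto
  qed
qed

subsection \<open>The model\<close>

definition reduct :: "(('c, 'f, 'p) form, 'f, 'p, 'd) struct \<Rightarrow> ('c, 'f, 'p, 'd) struct" where
  "reduct M = \<lparr>outer = outer M, inner = inner M, cint = (\<lambda>c. cint M (Old c)),
     fint = fint M, pint = pint M\<rparr>"

lemma is_struct_reduct: "is_struct (henkin_lang L) M \<Longrightarrow> is_struct L (reduct M)"
  by (simp add: is_struct_def reduct_def)

lemma val_reduct: "val (reduct M) s t = val M s (csubst_tm (\<lambda>c. Const (Old c)) t)"
  by (induction t) (simp_all add: reduct_def cong: map_cong)

lemma sat_reduct: "sat (reduct M) s A = sat M s (embed A)"
proof (induction A arbitrary: s)
  case (Pred p ts)
  have "map (val (reduct M) s) ts = map (val M s) (map (csubst_tm (\<lambda>c. Const (Old c))) ts)"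
    by (simp add: val_reduct)
  then show ?case
    by (simp only: sat.simps csubst.simps) (simp add: reduct_def)
qed (simp_all add: val_reduct, simp_all add: reduct_def)

theorem theorem5:
  fixes L :: "('c, 'f, 'p) lang" and \<Delta> :: "('c, 'f, 'p) form set"
  assumes "\<forall>A\<in>\<Delta>. wf_form L A"
    and "consistent L \<Delta>"
  shows "satisfiable L \<Delta>"
proof -
  let ?L = "henkin_lang L"
  \<comment> \<open>Keys already range over formulas of the extended language, so a single round of
    axioms suffices and no chain of languages is built.\<close>
  let ?T = "embed ` \<Delta> \<union> henkin ` {K. wf_form ?L (key_form K)}"
  have "wf_form ?L A" if "A \<in> ?T" for A
    using that assms(1) by (auto intro: wf_embed wf_henkin)
  with henkin_theory_consistent[OF assms(2)]
  obtain G where G: "?T \<subseteq> G" "maximal_consistent ?L G"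
    using ex_maximal_consistent[of ?T ?L] by metis
  interpret henkin_set ?L G
  proof (rule henkin_set_if_henkin_axioms[OF G(2)])
    show "henkin K \<in> G" if "wf_form ?L (key_form K)" for K
      using that G(1) by blast
  qed
  have "sat (reduct term_model) assign A" if "A \<in> \<Delta>" for A
  proof -
    have "embed A \<in> G" using that G(1) by blast
    with truth[of "embed A"] show ?thesis by (simp add: sat_reduct wf)
  qed
  moreover have "range assign \<subseteq> outer (reduct term_model)"
    using range_assign by (simp add: reduct_def)
  ultimately show ?thesis
    unfolding satisfiable_def using is_struct_reduct[OF is_struct_term_model] by blast
qed

end
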